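(* Let $p,q\ge 1$ be fixed integers, $\Sigma$ a fixed $q\times q$ positive definite matrix, and let the true coefficient matrix be $B_0=(B_{01}^T,0)^T\in\mathbb R^{p\times q}$, where $B_{01}\in\mathbb R^{p_1\times q}$ consists of the non-zero rows of $B_0$ and $0<p_1<p$. For each $n$, let $Y=XB_0+E$, where $X\in\mathbb R^{n\times p}$ is the design matrix and the rows of $E\in\mathbb R^{n\times q}$ are independent draws from $\mathcal N_q(0,\Sigma)$. Let $D^-(\cdot,F)$ be an inverse depth function on $\mathbb R^q$ with spherically symmetric reference distribution $F$, written $D^-(b,F)=p_F(\|b\|_2)$, where $p_F(r)$ is concave in $r$ and continuously differentiable at every $r\ne 0$. Let $B^*=\hat B_{\mathrm{LS}}=(X^TX)^{-}X^TY$, with rows $b_j^*$ and $r_j^*=\|b_j^*\|_2$, $1\le j\le p$, and let the one-step estimate be $$\hat B^{(1)}=\arg\min_{B\in\mathbb R^{p\times q}}\Big[\operatorname{Tr}\{(Y-XB)^T(Y-XB)\}+\lambda_n\sum_{j=1}^p p_F'(r_j^* )\,\|b_j\|_2\Big],$$ where $b_j$ denotes the $j$-th row of $B$. Assume: (i) $X^TX/n\to C$ for some positive definite matrix $C$; (ii) $p_F'(r_j^* )=O\big((r_j^* )^{-s}\big)$ for $1\le j\le p$, $0<r_j^*<\delta$, and some $s>0$, $\delta>0$; (iii) the sequence of tuning parameters $\lambda_n$ satisfies $\lambda_n/\sqrt n\to 0$ and $\lambda_n n^{(s-1)/2}\to\infty$. Write $\hat B^{(1)}=(\hat B_{11}^T,\hat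 B_{10}^T)^T$ with $\hat B_{11}\in\mathbb R^{p_1\times q}$ and $\hat B_{10}\in\mathbb R^{(p-p_1)\times q}$. Then, as $n\to\infty$: (1) $\operatorname{vec}(\hat B_{10})\to 0$ in probability; (2) $\sqrt n\,\big(\operatorname{vec}(\hat B_{11})-\operatorname{vec}(B_{01})\big)$ converges in distribution to $\mathcal N_{p_1q}\big(0,\Sigma\otimes C_{11}^{-1}\big)$, where $C_{11}$ is the first (upper-left) $p_1\times p_1$ block of $C$.
   Context: $\operatorname{vec}(A)$ is the stacked-column vectorization of a matrix $A$, $\otimes$ is the Kronecker product, and $A^-$ is a generalized inverse. A data depth on $\mathbb R^q$ is a scalar-valued function $D(x,F_X)$ of a point $x\in\mathbb R^q$ and the distribution $F_X$ of a random vector $X$ such that: (P1) $D(Ax+b,F_{AX+b})=D(x,F_X)$ for every non-singular $A$ and vector $b$; (P2) if $F_X$ has center of symmetry $\theta$, then $D(\theta,F_X)=\sup_x D(x,F_X)$; (P3) $D(x,F_X)\le D(\theta+a(x-\theta),F_X)$ for all $x$ and $a\in[0,1]$; (P4) $D(x,F_X)\to0$ as $\|x\|\to\infty$. An inverse depth function $D^-(\cdot,F)$ is a nonnegative-valued, bounded, monotonically decreasing one-to-one transformation of $D(\cdot,F)$. The reference distribution $F$ is a fixed probability distribution on $\mathbb R^q$, centered at the origin and spherically symmetric. By affine invariance, $D^-(b,F)$ then depends on $b$ only through $\|b\|_2$, so $D^-(b,F)=p_F(\|b\|_2)$ for some scalar-valued function $p_F$.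
   Formalization: Condition (ii) is taken as exact order: p_F'(r_j* ) is bounded above and below by positive multiples of (r_j* )^{-s}; with the upper bound alone (2) fails, e.g. p_F(r)=1-exp(-r), s=1, lambda_n=log n, C not block diagonal. *)

theory Defs
  imports "HOL-Probability.Probability"
begin

section \<open>Matrices\<close>

definition pos_def :: "real^'n^'n \<Rightarrow> bool" where
  "pos_def A \<longleftrightarrow> transpose A = A \<and> (\<forall>x. x \<noteq> 0 \<longrightarrow> x \<bullet> (A *v x) > 0)"

definition generalized_inverse :: "real^'n^'n \<Rightarrow> real^'n^'n \<Rightarrow> bool" where
  "generalized_inverse A G \<longleftrightarrow> A ** G ** A = A"

text \<open>The entries of vec(A) and the rows and columns of a Kronecker product are indexed by pairs.
  The pair (k, i) stands for position (k - 1) m + i of the stacked columns, where m is the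
  number of rows of the matrix (of the second factor, in the Kronecker product).\<close>

definition vec_cols :: "real^'n^'m \<Rightarrow> real^('n::finite \<times> 'm::finite)" where
  "vec_cols A = (\<chi> ki. A $ snd ki $ fst ki)"

definition kronecker :: "real^'n^'n \<Rightarrow> real^'m^'m \<Rightarrow> real^('n::finite \<times> 'm::finite)^('n \<times> 'm)" where
  "kronecker A B = (\<chi> ki lj. A $ fst ki $ fst lj * B $ snd ki $ snd lj)"

text \<open>The p coefficient rows are indexed by a sum type \<open>'a + 'b\<close>: the first p1 rows by \<open>'a\<close>, the
  remaining ones by \<open>'b\<close>. Both types are nonempty, hence 0 < p1 < p.\<close>

definition stack_rows :: "real^'q^'a \<Rightarrow> real^'q^'b \<Rightarrow> real^'q^('a::finite + 'b::finite)" where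
  "stack_rows A B = (\<chi> j. case j of Inl i \<Rightarrow> A $ i | Inr k \<Rightarrow> B $ k)"

definition top_rows :: "real^'q^('a::finite + 'b::finite) \<Rightarrow> real^'q^'a" where
  "top_rows A = (\<chi> i. A $ Inl i)"

definition bottom_rows :: "real^'q^('a::finite + 'b::finite) \<Rightarrow> real^'q^'b" where
  "bottom_rows A = (\<chi> k. A $ Inr k)"

definition upper_left :: "real^('a::finite + 'b::finite)^('a + 'b) \<Rightarrow> real^'a^'a" where
  "upper_left A = (\<chi> i j. A $ Inl i $ Inl j)"

text \<open>The sample size n varies, so a matrix with n rows is the family of its rows, of which
  only those with index less than n matter.\<close>

type_synonym 'c row_family = "nat \<Rightarrow> real^'c"

\<comment> \<open>the matrix product of the transpose of U with V, for U and V with n rows\<close>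
definition transp_mult :: "nat \<Rightarrow> 'c row_family \<Rightarrow> 'd row_family \<Rightarrow> real^'d^'c" where
  "transp_mult n U V = (\<chi> j k. \<Sum>i<n. U i $ j * V i $ k)"

section \<open>Probability\<close>

definition mvn_density :: "real^'n \<Rightarrow> real^'n^'n \<Rightarrow> real^'n \<Rightarrow> real" where
  "mvn_density \<mu> V x =
     exp (- ((x - \<mu>) \<bullet> (matrix_inv V *v (x - \<mu>))) / 2) / sqrt ((2 * pi) ^ CARD('n) * det V)"

text \<open>The multivariate normal distribution, for positive definite covariance matrices V.\<close>

definition mvnormal :: "real^'n \<Rightarrow> real^'n^'n \<Rightarrow> (real^'n) measure" where
  "mvnormal \<mu> V = density lborel (\<lambda>x. ennreal (mvn_density \<mu> V x))"

text \<open>The probability space may change with n.\<close>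

definition conv_in_prob ::
    "(nat \<Rightarrow> 'w measure) \<Rightarrow> (nat \<Rightarrow> 'w \<Rightarrow> 'a::euclidean_space) \<Rightarrow> 'a \<Rightarrow> bool" where
  "conv_in_prob M Z l \<longleftrightarrow>
     (\<forall>n. Z n \<in> borel_measurable (M n)) \<and>
     (\<forall>\<epsilon>>0. (\<lambda>n. measure (M n) {\<omega> \<in> space (M n). dist (Z n \<omega>) l > \<epsilon>}) \<longlonglongrightarrow> 0)"

definition conv_in_distr ::
    "(nat \<Rightarrow> 'w measure) \<Rightarrow> (nat \<Rightarrow> 'w \<Rightarrow> 'a::euclidean_space) \<Rightarrow> 'a measure \<Rightarrow> bool" where
  "conv_in_distr M Z N \<longleftrightarrow>
     (\<forall>n. Z n \<in> borel_measurable (M n)) \<and>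
     (\<forall>f::'a \<Rightarrow> real. continuous_on UNIV f \<and> bounded (range f) \<longrightarrow>
        (\<lambda>n. \<integral>\<omega>. f (Z n \<omega>) \<partial>(M n)) \<longlonglongrightarrow> (\<integral>x. f x \<partial>N))"

definition borel_prob :: "'a::euclidean_space measure \<Rightarrow> bool" where
  "borel_prob P \<longleftrightarrow> prob_space P \<and> sets P = sets borel"

section \<open>Data depth\<close>

definition center_of_symmetry :: "'a::euclidean_space \<Rightarrow> 'a measure \<Rightarrow> bool" where
  "center_of_symmetry \<theta> P \<longleftrightarrow> distr P borel (\<lambda>x. x - \<theta>) = distr P borel (\<lambda>x. \<theta> - x)"

definition spherically_symmetric :: "'a::euclidean_space measure \<Rightarrow> bool" where
  "spherically_symmetric P \<longleftrightarrow> (\<forall>T. orthogonal_transformation T \<longrightarrow> distr P borel T = P)"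

text \<open>The conditions are (P1) to (P4), for all Borel probability distributions P. The point \<open>\<theta>\<close> of
  (P3) is the center of symmetry of (P2), and symmetry is taken to be central symmetry.
  Boundedness above is stated because the supremum of an unbounded set of reals has no meaning.\<close>

definition data_depth :: "(real^'q \<Rightarrow> (real^'q) measure \<Rightarrow> real) \<Rightarrow> bool" where
  "data_depth D \<longleftrightarrow>
     (\<forall>P (A::real^'q^'q) b x. borel_prob P \<and> invertible A \<longrightarrow>
        D (A *v x + b) (distr P borel (\<lambda>y. A *v y + b)) = D x P) \<and>
     (\<forall>P \<theta>. borel_prob P \<and> center_of_symmetry \<theta> P \<longrightarrow>
        bdd_above (range (\<lambda>x. D x P)) \<and> D \<theta> P = (SUP x. D x P)) \<and>
     (\<forall>P \<theta> x a. borel_prob P \<and> center_of_symmetry \<theta> P \<and> 0 \<le> a \<and> a \<le> 1 \<longrightarrow>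
        D x P \<le> D (\<theta> + a *\<^sub>R (x - \<theta>)) P) \<and>
     (\<forall>P. borel_prob P \<longrightarrow> ((\<lambda>x. D x P) \<longlongrightarrow> 0) at_infinity)"

definition inverse_depth ::
    "(real^'q \<Rightarrow> (real^'q) measure \<Rightarrow> real) \<Rightarrow> (real^'q) measure \<Rightarrow> (real^'q \<Rightarrow> real) \<Rightarrow> bool" where
  "inverse_depth D F Dm \<longleftrightarrow>
     (\<exists>g. antimono_on (range (\<lambda>x. D x F)) g \<and> inj_on g (range (\<lambda>x. D x F)) \<and>
          (\<forall>x. Dm x = g (D x F))) \<and>
     (\<forall>x. Dm x \<ge> 0) \<and> bounded (range Dm)"

section \<open>The regression model and the one-step estimate\<close>

definition response ::
    "'p row_family \<Rightarrow> real^'q^'p \<Rightarrow> 'q row_family \<Rightarrow> 'q row_family" where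
  "response X B E = (\<lambda>i. X i v* B + E i)"

\<comment> \<open>G is a generalized inverse of the Gram matrix of X\<close>
definition ls_estimate ::
    "nat \<Rightarrow> real^'p^'p \<Rightarrow> 'p row_family \<Rightarrow> 'q row_family \<Rightarrow> real^'q^'p" where
  "ls_estimate n G X Y = G ** transp_mult n X Y"

text \<open>The condition that \<open>p\<^sub>F'(r) = O(r\<^sup>-\<^sup>s)\<close> is read as exact order, a bound from both sides, as
  the oracle property requires. The upper bound alone also holds for the bounded derivative of
  \<open>p\<^sub>F(r) = 1 - exp(-r)\<close>; then the penalty is asymptotically negligible because \<open>\<lambda>\<^sub>n / \<surd>n\<close> tends
  to 0, and the limiting covariance is that of least squares, with the upper-left block of the
  inverse of C in place of the inverse of the upper-left block.\<close>

definition exact_order_on :: "real set \<Rightarrow> (real \<Rightarrow> real) \<Rightarrow> (real \<Rightarrow> real) \<Rightarrow> bool" where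
  "exact_order_on S f g \<longleftrightarrow>
     (\<exists>c>0. \<exists>K>0. \<forall>r\<in>S. c * \<bar>g r\<bar> \<le> \<bar>f r\<bar> \<and> \<bar>f r\<bar> \<le> K * \<bar>g r\<bar>)"

text \<open>The library's \<open>deriv\<close> is an unspecified number where pF is not differentiable. The
  objective is therefore meaningful only if all rows of Bstar are nonzero.\<close>

definition one_step_objective ::
    "nat \<Rightarrow> 'p row_family \<Rightarrow> 'q row_family \<Rightarrow> real \<Rightarrow> (real \<Rightarrow> real) \<Rightarrow> real^'q^'p \<Rightarrow> real^'q^'p \<Rightarrow> real"
where
  "one_step_objective n X Y lam pF Bstar B =
     (let R = (\<lambda>i. Y i - X i v* B) in trace (transp_mult n R R)) +
     lam * (\<Sum>j\<in>UNIV. deriv pF (norm (Bstar $ j)) * norm (B $ j))"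

end

theory Submission
  imports Defs
begin

text \<open>Put \<open>C\<^sub>n = X\<^sup>TX/n\<close>, \<open>W\<^sub>n = X\<^sup>TE/\<surd>n\<close> and \<open>B = B\<^sub>0 + U/\<surd>n\<close>. Up to a constant the objective is
  \<open>\<langle>U, C\<^sub>n U\<rangle> - 2\<langle>U, W\<^sub>n\<rangle>\<close> plus the weighted row norms, and \<open>\<surd>n (B\<^sup>* - B\<^sub>0) = C\<^sub>n\<^sup>-\<^sup>1 W\<^sub>n\<close> is exactly normal,
  hence tight. On an event where it is bounded by \<open>K\<close>, the weight of a zero row is at least of order
  \<open>\<lambda>\<^sub>n n\<^bsup>(s-1)/2\<^esup> \<rightarrow> \<infinity>\<close> and eventually beats the bounded gradient of the quadratic part, so these rows of
  the minimiser vanish exactly; the weights of the other rows are \<open>O(\<lambda>\<^sub>n/\<surd>n) \<rightarrow> 0\<close>, since \<open>p\<^sub>F'\<close> is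
  nonnegative and decreasing, so the upper rows of the minimiser differ by \<open>o(1)\<close> from those of the
  least squares problem restricted to these rows, which are exactly \<open>\<N>(0, \<Sigma> \<otimes> C\<^sub>n\<^sub>,\<^sub>1\<^sub>1\<^sup>-\<^sup>1)\<close>. The exact laws come
  from uniqueness of multivariate characteristic functions, the passage to the limit in \<open>n\<close> from
  Scheffe's lemma for the densities.\<close>

section \<open>Positive definite matrices\<close>

text \<open>The selection of rows and the limit are kept apart. \<open>penalized_minimizer\<close>
  is a deterministic inequality with explicit constants, proved by comparing the minimiser with
  three competitors, so neither convergence of random convex functions nor continuity of the arg min
  enters. Randomness comes in through one tight variable: once the scaled least squares error is
  bounded by \<open>K\<close>, all weights are under control for large \<open>n\<close>. On a zero
  row the norm of the pilot estimate is at most \<open>K / sqrt n\<close>, so the lower half of the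
  exact order gives \<open>deriv pF\<close> at least a constant times \<open>n powr (s / 2)\<close>
  there. The rescaling contributes the factor \<open>lam n / sqrt n\<close>, and the product is the
  quantity in the second rate condition. Since the errors are normal, linear statistics have exact
  laws as soon as the Gram matrix is positive definite; only the covariances move with
  \<open>n\<close>, which is why convergence of densities can replace a central limit theorem. Exact
  zeros in the lower rows leave a regression on the first columns of the design alone, hence the
  inverse of a block and not the block of an inverse.\<close>

lemma bounded_bilinear_matrix_mult:
  "bounded_bilinear (\<lambda>(A::real^'m^'n) (B::real^'k^'m). A ** B)"
  unfolding bilinear_conv_bounded_bilinear[symmetric] bilinear_def
  by (auto intro!: linearI simp: matrix_matrix_mult_def vec_eq_iff sum.distrib scaleR_sum_right
      algebra_simps sum_distrib_left)

lemma inner_transpose_matrix_vector: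
  fixes A :: "real^'n^'m"
  shows "(transpose A *v x) \<bullet> y = x \<bullet> (A *v y)"
  by (metis dot_lmul_matrix transpose_matrix_vector)

lemma inner_matrix_vector_sum:
  fixes A :: "real^'n^'n"
  shows "x \<bullet> (A *v y) = (\<Sum>i\<in>UNIV. \<Sum>j\<in>UNIV. A $ i $ j * x $ i * y $ j)"
  by (simp add: inner_vec_def matrix_vector_mult_def sum_distrib_left mult_ac)

lemma matrix_inv_mult:
  fixes A :: "real^'n^'n"
  assumes "invertible A"
  shows "A ** matrix_inv A = mat 1" "matrix_inv A ** A = mat 1"
  using someI_ex[OF assms[unfolded invertible_def]] by (simp_all add: matrix_inv_def)

lemma invertible_transpose_matrix:
  fixes A :: "real^'n^'n"
  shows "invertible (transpose A) \<longleftrightarrow> invertible A"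
  by (simp add: invertible_det_nz)

lemma inverse_eqI:
  fixes A :: "real^'n^'n"
  assumes "A ** B = mat 1"
  shows "matrix_inv A = B" "invertible A"
proof -
  have *: "B ** A = mat 1" using assms matrix_left_right_inverse by blast
  then show inv: "invertible A" using assms by (auto simp: invertible_def)
  have "matrix_inv A = matrix_inv A ** (A ** B)" using assms by simp
  also have "\<dots> = B" by (simp add: matrix_mul_assoc matrix_inv_mult(2)[OF inv])
  finally show "matrix_inv A = B" .
qed

lemma pos_def_invertible:
  fixes A :: "real^'n^'n"
  assumes "pos_def A" shows "invertible A"
proof -
  have "\<forall>x. A *v x = 0 \<longrightarrow> x = 0"
    using assms by (metis pos_def_def inner_zero_right less_irrefl)
  then show ?thesis
    by (simp add: invertible_left_inverse matrix_left_invertible_ker)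
qed

lemma pos_def_gram:
  fixes S :: "real^'n^'n"
  assumes "invertible S" shows "pos_def (S ** transpose S)"
proof -
  have "transpose S *v x \<noteq> 0" if "x \<noteq> 0" for x
    using that assms invertible_transpose_matrix[of S] by (metis invertible_left_inverse matrix_left_invertible_ker)
  then show ?thesis
    by (auto simp: pos_def_def matrix_transpose_mul inner_transpose_matrix_vector[symmetric]
        matrix_vector_mul_assoc[symmetric])
qed

text \<open>If an entry \<open>V\<^sub>i\<^sub>i\<close> is positive, then \<open>V - v v\<^sup>T\<close> with
  \<open>v = V e\<^sub>i / \<surd>V\<^sub>i\<^sub>i\<close> is positive semidefinite and has vanishing \<open>i\<close>-th row.\<close>

lemma psd_decomposition:
  fixes V :: "real^'n^'n"
  assumes "finite I" "transpose V = V" "\<And>x. x \<bullet> (V *v x) \<ge> 0" "\<And>i j. i \<notin> I \<Longrightarrow> V $ i $ j = 0"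
  shows "\<exists>v :: 'n \<Rightarrow> real^'n. \<forall>i j. V $ i $ j = (\<Sum>k\<in>I. v k $ i * v k $ j)"
  using assms
proof (induction I arbitrary: V rule: finite_induct)
  case empty
  then show ?case by auto
next
  case (insert a I)
  note sym = \<open>transpose V = V\<close>
  have sym': "V $ i $ j = V $ j $ i" for i j
    using sym by (metis transpose_def vec_lambda_beta)
  define c where "c = V $ a $ a"
  define u where "u = V *v axis a 1"
  have u: "u $ i = V $ i $ a" for i by (simp add: u_def matrix_vector_mul_component inner_axis)
  have uc: "axis a 1 \<bullet> (V *v axis a 1) = c" by (simp add: c_def u u_def[symmetric] inner_axis')
  have uV: "axis a 1 \<bullet> (V *v x) = x \<bullet> u" for x
    unfolding u_def by (metis inner_commute inner_transpose_matrix_vector sym)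
  \<comment> \<open>Nonnegativity along the line through \<open>x\<close> in direction
    \<open>axis a 1\<close>. For \<open>c = 0\<close> the expression is affine in \<open>t\<close>,
    which forces \<open>x \<bullet> u = 0\<close>; for \<open>c > 0\<close> the minimising
    \<open>t\<close> gives the Schur complement bound for \<open>V'\<close>.\<close>
  have quad: "0 \<le> x \<bullet> (V *v x) + 2 * t * (x \<bullet> u) + t\<^sup>2 * c" for x t
  proof -
    have "0 \<le> (x + t *\<^sub>R axis a 1) \<bullet> (V *v (x + t *\<^sub>R axis a 1))" by (rule insert.prems)
    also have "\<dots> = x \<bullet> (V *v x) + 2 * t * (x \<bullet> u) + t\<^sup>2 * c"
      by (simp add: matrix_vector_mult_scaleR uc uV u_def[symmetric] inner_add_left inner_add_right
          algebra_simps power2_eq_square) (simp add: uV u_def[symmetric] uc[folded u_def])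
    finally show ?thesis .
  qed
  have c0: "c \<ge> 0" using quad[of 0 1] by simp
  have u0: "x \<bullet> u = 0" if "c = 0" for x
  proof (rule ccontr)
    assume "x \<bullet> u \<noteq> 0"
    then show False
      using quad[of x "- (x \<bullet> (V *v x) + 1) / (2 * (x \<bullet> u))"] that by (simp add: field_simps)
  qed
  \<comment> \<open>As division by zero gives 0, \<open>v\<close> vanishes for \<open>c = 0\<close>,
    and \<open>vv\<close> holds in both cases.\<close>
  define v where "v = (1 / sqrt c) *\<^sub>R u"
  have vv: "v $ i * v $ j = u $ i * u $ j / c" for i j
    using c0 by (simp add: v_def)
  define V' where "V' = (\<chi> i j. V $ i $ j - v $ i * v $ j)"
  have "transpose V' = V'"
    by (simp add: V'_def transpose_def vec_eq_iff sym' mult.commute)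
  moreover have "x \<bullet> (V' *v x) \<ge> 0" for x
  proof -
    have "x \<bullet> (V' *v x) = x \<bullet> (V *v x) - (x \<bullet> v)\<^sup>2"
      unfolding inner_matrix_vector_sum
      by (simp add: V'_def inner_vec_def power2_eq_square sum_product left_diff_distrib
          sum_subtractf algebra_simps)
    also have "(x \<bullet> v)\<^sup>2 = (x \<bullet> u)\<^sup>2 / c"
      using c0 by (simp add: v_def power_divide)
    also have "x \<bullet> (V *v x) - (x \<bullet> u)\<^sup>2 / c \<ge> 0"
    proof (cases "c = 0")
      case True then show ?thesis using insert.prems(2) by simp
    next
      case False
      then show ?thesis using quad[of x "- (x \<bullet> u) / c"]
        by (simp add: field_simps power2_eq_square)
    qed
    finally show ?thesis .
  qed
  moreover have "V' $ i $ j = 0" if "i \<notin> I" for i j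
  proof (cases "i = a")
    case True
    show ?thesis
    proof (cases "c = 0")
      case True
      then have "u = 0" using u0[of u] by simp
      then have "V $ j $ a = 0" using u by (metis zero_index)
      then show ?thesis using \<open>u = 0\<close> \<open>i = a\<close> by (simp add: V'_def v_def sym')
    next
      case False
      then show ?thesis using \<open>i = a\<close> by (simp add: V'_def vv u c_def sym')
    qed
  next
    case False
    then have "V $ i $ k = 0" for k using that insert.prems by simp
    then show ?thesis by (simp add: V'_def vv u)
  qed
  ultimately obtain w :: "'n \<Rightarrow> real^'n" where
    w: "\<And>i j. V' $ i $ j = (\<Sum>k\<in>I. w k $ i * w k $ j)"
    using insert.IH by blast
  have "V $ i $ j = (\<Sum>k\<in>insert a I. (w(a := v)) k $ i * (w(a := v)) k $ j)" for i j
  proof -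
    have "(\<Sum>k\<in>I. (w(a := v)) k $ i * (w(a := v)) k $ j) = (\<Sum>k\<in>I. w k $ i * w k $ j)"
      using insert.hyps by (intro sum.cong) auto
    then show ?thesis
      using insert.hyps w[of i j] by (simp add: V'_def algebra_simps)
  qed
  then show ?case by blast
qed

text \<open>The semidefinite decomposition over all indices yields one vector per index; as columns
  they form a square \<open>S\<close>, invertible because \<open>det V = (det S)\<^sup>2\<close>.
  Determinants, inverses, Kronecker products and normal laws are then treated through this
  factor.\<close>

lemma pos_def_decomposition:
  fixes V :: "real^'n^'n"
  assumes "pos_def V"
  obtains S :: "real^'n^'n" where "V = S ** transpose S" "invertible S"
proof -
  have "x \<bullet> (V *v x) \<ge> 0" for x
    using assms by (cases "x = 0") (auto simp: pos_def_def less_imp_le)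
  then obtain v :: "'n \<Rightarrow> real^'n" where v: "\<And>i j. V $ i $ j = (\<Sum>k\<in>UNIV. v k $ i * v k $ j)"
    using psd_decomposition[of UNIV V] assms by (auto simp: pos_def_def)
  define S :: "real^'n^'n" where "S = (\<chi> i k. v k $ i)"
  have VS: "V = S ** transpose S"
    by (simp add: vec_eq_iff v S_def matrix_matrix_mult_def transpose_def)
  moreover have "det V \<noteq> 0" using pos_def_invertible[OF assms] by (simp add: invertible_det_nz)
  then have "invertible S" using VS by (simp add: det_mul invertible_det_nz)
  ultimately show ?thesis using that by blast
qed

lemma pos_def_det_pos:
  fixes V :: "real^'n^'n"
  assumes "pos_def V" shows "det V > 0"
proof -
  obtain S :: "real^'n^'n" where S: "V = S ** transpose S" "invertible S"
    using pos_def_decomposition[OF assms] .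
  then show ?thesis by (auto simp: det_mul invertible_det_nz zero_less_mult_iff linorder_neq_iff)
qed

lemma matrix_inv_gram:
  fixes S :: "real^'n^'n"
  assumes "invertible S"
  shows "matrix_inv (S ** transpose S) = transpose (matrix_inv S) ** matrix_inv S"
proof (rule inverse_eqI)
  have "transpose S ** transpose (matrix_inv S) = mat 1"
    using assms by (metis matrix_inv_mult(2) matrix_transpose_mul transpose_mat)
  then have "S ** (transpose S ** transpose (matrix_inv S)) ** matrix_inv S = mat 1"
    using assms by (simp add: matrix_inv_mult(1))
  then show "(S ** transpose S) ** (transpose (matrix_inv S) ** matrix_inv S) = mat 1"
    by (simp add: matrix_mul_assoc)
qed

lemma pos_def_matrix_inv:
  fixes V :: "real^'n^'n"
  assumes "pos_def V" shows "pos_def (matrix_inv V)"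
proof -
  obtain S :: "real^'n^'n" where S: "V = S ** transpose S" "invertible S"
    using pos_def_decomposition[OF assms] .
  have "invertible (transpose (matrix_inv S))"
    using S(2) by (metis inverse_eqI(2) invertible_transpose_matrix matrix_inv_mult(2))
  from pos_def_gram[OF this] show ?thesis
    using S by (simp add: matrix_inv_gram)
qed

text \<open>The mixed-product rule: a sum over pairs of indices factors into two sums. Inverses and
  Gram factors of Kronecker products can therefore be formed factor by factor.\<close>

lemma kronecker_mult:
  "kronecker A B ** kronecker C D = kronecker (A ** C) (B ** D)"
proof -
  have "(\<Sum>k\<in>UNIV. A $ fst i $ fst k * B $ snd i $ snd k * (C $ fst k $ fst j * D $ snd k $ snd j)) =
    (\<Sum>k\<in>UNIV. A $ fst i $ k * C $ k $ fst j) * (\<Sum>k\<in>UNIV. B $ snd i $ k * D $ k $ snd j)"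
    for i j :: "'a \<times> 'b"
    unfolding sum_product
    by (simp add: UNIV_Times_UNIV[symmetric] sum.cartesian_product case_prod_beta mult_ac
        del: UNIV_Times_UNIV)
  then show ?thesis
    by (simp add: kronecker_def matrix_matrix_mult_def vec_eq_iff)
qed

lemma kronecker_mat_1: "kronecker (mat 1) (mat 1) = mat 1"
  by (auto simp: kronecker_def mat_def vec_eq_iff prod_eq_iff)

lemma kronecker_transpose: "transpose (kronecker A B) = kronecker (transpose A) (transpose B)"
  by (simp add: kronecker_def transpose_def vec_eq_iff)

lemma matrix_inv_kronecker:
  assumes "invertible A" "invertible B"
  shows "matrix_inv (kronecker A B) = kronecker (matrix_inv A) (matrix_inv B)"
    and "invertible (kronecker A B)"
  by (rule inverse_eqI[of _ "kronecker (matrix_inv A) (matrix_inv B)"];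
      simp add: kronecker_mult matrix_inv_mult(1) assms kronecker_mat_1)+

lemma pos_def_kronecker:
  fixes A :: "real^'m^'m" and B :: "real^'n^'n"
  assumes "pos_def A" "pos_def B" shows "pos_def (kronecker A B)"
proof -
  obtain S :: "real^'m^'m" and T :: "real^'n^'n" where S: "A = S ** transpose S" "invertible S" "B = T ** transpose T" "invertible T"
    using pos_def_decomposition[OF assms(1)] pos_def_decomposition[OF assms(2)] by metis
  then have "kronecker A B = kronecker S T ** transpose (kronecker S T)"
    by (simp add: kronecker_transpose kronecker_mult)
  then show ?thesis
    using pos_def_gram matrix_inv_kronecker(2)[OF S(2,4)] by metis
qed

text \<open>The inner product on matrices is the Frobenius one, so a quadratic form in a coefficient
  matrix splits over the response columns, and symmetry and positivity reduce to vectors.\<close>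

lemma inner_matrix_mult_columns:
  fixes A :: "real^'p^'p" and G H :: "real^'q^'p"
  shows "G \<bullet> (A ** H) = (\<Sum>k\<in>UNIV. column k G \<bullet> (A *v column k H))"
  by (simp add: inner_vec_def matrix_matrix_mult_def matrix_vector_mult_def column_def)
     (rule sum.swap)

text \<open>The form attains a positive minimum on the compact unit sphere, and homogeneity of
  degree two carries that value to all \<open>H\<close>.\<close>

lemma pos_def_coercive:
  fixes A :: "real^'p^'p"
  assumes "pos_def A"
  obtains c where "c > 0" "\<And>H::real^'q^'p. H \<bullet> (A ** H) \<ge> c * (norm H)\<^sup>2"
proof -
  have pos: "H \<bullet> (A ** H) > 0" if "H \<noteq> 0" for H :: "real^'q^'p"
  proof -
    obtain i k where "H $ i $ k \<noteq> 0"
      using \<open>H \<noteq> 0\<close> by (metis vec_eq_iff zero_index)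
    then have "column k H \<noteq> 0"
      by (auto simp: vec_eq_iff column_def)
    moreover have "column k H \<bullet> (A *v column k H) \<ge> 0" for k
      using assms by (cases "column k H = 0") (auto simp: pos_def_def less_imp_le)
    ultimately show ?thesis
      unfolding inner_matrix_mult_columns using assms
      by (intro sum_pos2[of _ k]) (auto simp: pos_def_def)
  qed
  have "continuous_on (sphere 0 1) (\<lambda>H::real^'q^'p. H \<bullet> (A ** H))"
    by (intro continuous_intros bounded_bilinear.continuous_on[OF bounded_bilinear_matrix_mult])
  moreover have "sphere (0::real^'q^'p) 1 \<noteq> {}" by simp
  ultimately obtain H0 where H0: "H0 \<in> sphere (0::real^'q^'p) 1"
      "\<And>H::real^'q^'p. H \<in> sphere 0 1 \<Longrightarrow> H0 \<bullet> (A ** H0) \<le> H \<bullet> (A ** H)"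
    using continuous_attains_inf[of "sphere 0 1" "\<lambda>H::real^'q^'p. H \<bullet> (A ** H)"] by auto
  have "H \<bullet> (A ** H) \<ge> H0 \<bullet> (A ** H0) * (norm H)\<^sup>2" for H :: "real^'q^'p"
  proof (cases "H = 0")
    case False
    have "H0 \<bullet> (A ** H0) \<le> ((1 / norm H) *\<^sub>R H) \<bullet> (A ** ((1 / norm H) *\<^sub>R H))"
      using False by (intro H0) simp
    also have "\<dots> = (H \<bullet> (A ** H)) / (norm H)\<^sup>2"
      by (simp add: bounded_bilinear.scaleR_right[OF bounded_bilinear_matrix_mult] power2_eq_square)
    finally show ?thesis using False by (simp add: field_simps)
  qed simp
  moreover have "H0 \<bullet> (A ** H0) > 0"
    using H0(1) by (intro pos) auto
  ultimately show ?thesis using that by blast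
qed

lemma pos_def_coerciveI:
  fixes A :: "real^'p^'p"
  assumes "transpose A = A" "c > 0" "\<And>H::real^'q^'p. H \<bullet> (A ** H) \<ge> c * (norm H)\<^sup>2"
  shows "pos_def A"
proof -
  have "x \<bullet> (A *v x) > 0" if "x \<noteq> 0" for x
  proof -
    \<comment> \<open>Every column is a copy of \<open>x\<close>, so the matrix form is
      \<open>CARD('q)\<close> times the form of \<open>x\<close>.\<close>
    define H :: "real^'q^'p" where "H = (\<chi> j k. x $ j)"
    have "column k H = x" for k by (simp add: H_def column_def vec_eq_iff)
    moreover have "H \<noteq> 0" using that by (auto simp: H_def vec_eq_iff)
    then have "c * (norm H)\<^sup>2 > 0" using assms(2) by simp
    then have "H \<bullet> (A ** H) > 0" using assms(3)[of H] by linarith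
    ultimately show ?thesis by (simp add: inner_matrix_mult_columns zero_less_mult_iff)
  qed
  then show ?thesis using assms(1) by (simp add: pos_def_def)
qed

text \<open>Positive definiteness is an open condition: a perturbation smaller than
  \<open>c / (2 * K)\<close> costs at most half of the coercivity constant of the limit, which
  leaves one constant for all large \<open>n\<close>.\<close>

lemma eventually_coercive:
  fixes A :: "real^'p^'p"
  assumes "\<And>n. transpose (An n) = An n" "An \<longlonglongrightarrow> A" "pos_def A"
  obtains c where "c > 0"
    "\<forall>\<^sub>F n in sequentially. \<forall>H::real^'q^'p. H \<bullet> (An n ** H) \<ge> c * (norm H)\<^sup>2"
    "\<forall>\<^sub>F n in sequentially. pos_def (An n)"
proof -
  obtain c where c: "c > 0" "\<And>H::real^'q^'p. H \<bullet> (A ** H) \<ge> c * (norm H)\<^sup>2"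
    using pos_def_coercive[OF assms(3)] by metis
  obtain K where K: "K > 0"
    "\<And>(M::real^'p^'p) (H::real^'q^'p). norm (M ** H) \<le> norm M * norm H * K"
    using bounded_bilinear.pos_bounded[OF bounded_bilinear_matrix_mult] by metis
  have "\<forall>\<^sub>F n in sequentially. dist (An n) A < c / (2 * K)"
    using c K by (intro tendstoD[OF assms(2)]) simp
  then have ev: "\<forall>\<^sub>F n in sequentially. \<forall>H::real^'q^'p. H \<bullet> (An n ** H) \<ge> (c / 2) * (norm H)\<^sup>2"
  proof eventually_elim
    case (elim n)
    show ?case
    proof
      fix H :: "real^'q^'p"
      have "\<bar>H \<bullet> ((An n - A) ** H)\<bar> \<le> norm H * norm ((An n - A) ** H)"
        by (rule Cauchy_Schwarz_ineq2)
      also have "\<dots> \<le> norm H * (c / (2 * K) * norm H * K)"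
        using elim K by (intro mult_left_mono order_trans[OF K(2)] mult_right_mono)
          (auto simp: dist_norm)
      also have "\<dots> = (c / 2) * (norm H)\<^sup>2"
        using K by (simp add: power2_eq_square)
      finally have "\<bar>H \<bullet> ((An n - A) ** H)\<bar> \<le> (c / 2) * (norm H)\<^sup>2" .
      moreover have "H \<bullet> (An n ** H) = H \<bullet> (A ** H) + H \<bullet> ((An n - A) ** H)"
        by (simp add: bounded_bilinear.diff_left[OF bounded_bilinear_matrix_mult] inner_diff_right)
      ultimately show "H \<bullet> (An n ** H) \<ge> (c / 2) * (norm H)\<^sup>2"
        using c(2)[of H] by (simp add: field_simps)
    qed
  qed
  moreover from ev have "\<forall>\<^sub>F n in sequentially. pos_def (An n)"
    by eventually_elim (use c assms(1) in \<open>auto intro!: pos_def_coerciveI[where c = "c/2"]\<close>)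
  ultimately show ?thesis using that[of "c / 2"] c by simp
qed

section \<open>Linear change of variables for Lebesgue measure\<close>

lemma prod_Basis_cart: "(\<Prod>b\<in>(Basis::(real^'n) set). f b) = (\<Prod>i\<in>UNIV. f (axis i 1))"
proof -
  have B: "(Basis::(real^'n) set) = range (\<lambda>i. axis i 1)" by (auto simp: Basis_vec_def)
  have "inj (\<lambda>i::'n. axis i (1::real))" by (auto simp: inj_on_def axis_eq_axis)
  from prod.reindex[OF this, of f] show ?thesis by (simp add: B o_def)
qed

text \<open>Integrate over the \<open>b\<close>-coordinate first. As \<open>a\<close> differs from
  \<open>b\<close>, the \<open>a\<close>-coordinate is then fixed, and the shear acts as a
  one-dimensional translation by \<open>f a\<close>.\<close>

lemma nn_integral_lborel_shear:
  fixes a b :: "'a::euclidean_space"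
  assumes ab: "a \<in> Basis" "b \<in> Basis" "a \<noteq> b" and [measurable]: "g \<in> borel_measurable borel"
  shows "(\<integral>\<^sup>+x. g (x + (x \<bullet> a) *\<^sub>R b) \<partial>lborel) = (\<integral>\<^sup>+x. g x \<partial>lborel)"
proof -
  interpret product_sigma_finite "\<lambda>_::'a. lborel :: real measure" ..
  let ?B = "Basis - {b}" and ?S = "\<lambda>f. \<Sum>c\<in>Basis. f c *\<^sub>R c :: 'a"
  have Bas: "insert b ?B = Basis" using ab by auto
  have *: "(\<integral>\<^sup>+x. h x \<partial>lborel) =
      (\<integral>\<^sup>+f. (\<integral>\<^sup>+y. h (y *\<^sub>R b + (\<Sum>c\<in>?B. f c *\<^sub>R c)) \<partial>lborel) \<partial>Pi\<^sub>M ?B (\<lambda>_. lborel))"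
    if [measurable]: "h \<in> borel_measurable borel" for h :: "'a \<Rightarrow> ennreal"
  proof -
    have "(\<integral>\<^sup>+x. h x \<partial>lborel) = (\<integral>\<^sup>+f. h (?S f) \<partial>Pi\<^sub>M (insert b ?B) (\<lambda>_. lborel))"
      unfolding Bas by (subst lborel_eq) (simp add: nn_integral_distr)
    also have "\<dots> = (\<integral>\<^sup>+f. (\<integral>\<^sup>+y. h (?S (f(b := y))) \<partial>lborel) \<partial>Pi\<^sub>M ?B (\<lambda>_. lborel))"
      by (intro product_nn_integral_insert) (auto simp: Bas)
    also have "\<dots> = (\<integral>\<^sup>+f. (\<integral>\<^sup>+y. h (y *\<^sub>R b + (\<Sum>c\<in>?B. f c *\<^sub>R c)) \<partial>lborel) \<partial>Pi\<^sub>M ?B (\<lambda>_. lborel))"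
      by (intro nn_integral_cong arg_cong[where f = h]) (simp add: sum.remove[OF _ ab(2)])
    finally show ?thesis .
  qed
  have "(\<integral>\<^sup>+x. g (x + (x \<bullet> a) *\<^sub>R b) \<partial>lborel) =
      (\<integral>\<^sup>+f. (\<integral>\<^sup>+y. g ((f a + y) *\<^sub>R b + (\<Sum>c\<in>?B. f c *\<^sub>R c)) \<partial>lborel) \<partial>Pi\<^sub>M ?B (\<lambda>_. lborel))"
  proof (subst *, simp, intro nn_integral_cong arg_cong[where f = g])
    fix f :: "'a \<Rightarrow> real" and y :: real
    have "(y *\<^sub>R b + (\<Sum>c\<in>?B. f c *\<^sub>R c)) \<bullet> a = f a"
      using ab by (simp add: inner_add_left inner_sum_left inner_Basis if_distrib sum.delta cong: if_cong)
    then show "y *\<^sub>R b + (\<Sum>c\<in>?B. f c *\<^sub>R c) + ((y *\<^sub>R b + (\<Sum>c\<in>?B. f c *\<^sub>R c)) \<bullet> a) *\<^sub>R b =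
        (f a + y) *\<^sub>R b + (\<Sum>c\<in>?B. f c *\<^sub>R c)"
      by (simp add: algebra_simps)
  qed
  also have "\<dots> = (\<integral>\<^sup>+f. (\<integral>\<^sup>+y. g (y *\<^sub>R b + (\<Sum>c\<in>?B. f c *\<^sub>R c)) \<partial>lborel) \<partial>Pi\<^sub>M ?B (\<lambda>_. lborel))"
  proof (rule nn_integral_cong)
    fix f :: "'a \<Rightarrow> real"
    show "(\<integral>\<^sup>+y. g ((f a + y) *\<^sub>R b + (\<Sum>c\<in>?B. f c *\<^sub>R c)) \<partial>lborel) =
        (\<integral>\<^sup>+y. g (y *\<^sub>R b + (\<Sum>c\<in>?B. f c *\<^sub>R c)) \<partial>lborel)"
      using nn_integral_real_affine[of "\<lambda>y. g (y *\<^sub>R b + (\<Sum>c\<in>?B. f c *\<^sub>R c))" 1 "f a"]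
      by simp
  qed
  also have "\<dots> = (\<integral>\<^sup>+x. g x \<partial>lborel)" by (simp add: *)
  finally show ?thesis .
qed

text \<open>The preimage of a box is the box with permuted corners, whose side lengths have the same
  product; Lebesgue measure is determined by its values on boxes.\<close>

lemma nn_integral_lborel_permute:
  fixes p :: "'n::finite \<Rightarrow> 'n"
  assumes p: "p permutes UNIV" and [measurable]: "g \<in> borel_measurable borel"
  shows "(\<integral>\<^sup>+x. g (\<chi> i. x $ p i) \<partial>lborel) = (\<integral>\<^sup>+x. g x \<partial>(lborel :: (real^'n) measure))"
proof -
  let ?h = "\<lambda>x::real^'n. \<chi> i. x $ p i"
  have lin: "linear ?h" by (rule linearI) (auto simp: vec_eq_iff)
  then have [measurable]: "?h \<in> borel_measurable borel"
    by (intro borel_measurable_continuous_onI linear_continuous_on) (simp add: linear_linear)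
  have "lborel = distr lborel borel ?h"
  proof (rule lborel_eqI)
    fix l u :: "real^'n" assume le: "\<And>b. b \<in> Basis \<Longrightarrow> l \<bullet> b \<le> u \<bullet> b"
    define l' u' where "l' = (\<chi> i. l $ inv p i)" "u' = (\<chi> i. u $ inv p i)"
    have pp: "p (inv p i) = i" "inv p (p i) = i" for i
      using p by (simp_all add: permutes_inverses)
    have leij: "l $ i \<le> u $ i" for i
      using le[of "axis i 1"] by (auto simp: inner_axis Basis_vec_def)
    have "?h -` box l u = box l' u'"
      by (auto simp: mem_box_cart l'_u'_def) (metis pp)+
    then have "emeasure (distr lborel borel ?h) (box l u) = emeasure lborel (box l' u')"
      by (simp add: emeasure_distr)
    also have "\<dots> = (\<Prod>b\<in>Basis. (u' - l') \<bullet> b)"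
      using leij by (intro emeasure_lborel_box) (auto simp: Basis_vec_def inner_axis l'_u'_def)
    also have "(\<Prod>b\<in>Basis. (u' - l') \<bullet> b) = (\<Prod>i\<in>UNIV. (u' - l') $ i)"
      by (simp add: prod_Basis_cart inner_axis)
    also have "(\<Prod>i\<in>UNIV. (u' - l') $ i) = (\<Prod>i\<in>UNIV. (u - l) $ i)"
      using prod.permute[OF permutes_inv[OF p], of "\<lambda>i. (u - l) $ i"]
      by (simp add: l'_u'_def o_def)
    also have "\<dots> = (\<Prod>b\<in>Basis. (u - l) \<bullet> b)"
      by (simp add: prod_Basis_cart inner_axis)
    finally show "emeasure (distr lborel borel ?h) (box l u) = (\<Prod>b\<in>Basis. (u - l) \<bullet> b)" .
  qed simp
  then have "(\<integral>\<^sup>+x. g x \<partial>lborel) = (\<integral>\<^sup>+x. g x \<partial>distr lborel borel ?h)" by (rule arg_cong)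
  then show ?thesis by (simp add: nn_integral_distr)
qed

text \<open>The change of variables formulas of the library require the index type to be well-ordered,
  which a product of finite types is not.\<close>

lemma nn_integral_lborel_linear:
  fixes A :: "real^'n^'n"
  assumes "det A \<noteq> 0" "g \<in> borel_measurable borel"
  shows "ennreal \<bar>det A\<bar> * (\<integral>\<^sup>+x. g (A *v x) \<partial>lborel) = (\<integral>\<^sup>+x. g x \<partial>lborel)"
  using assms
\<comment> \<open>The cases are products, matrices with a zero row (excluded by the determinant),
  diagonal matrices, transpositions of two coordinates and shears. \<open>g\<close> is arbitrary
  because the product case applies the hypothesis for \<open>B\<close> to \<open>g\<close> composed
  with \<open>A\<close>.\<close>
proof (induction A arbitrary: g rule: induct_matrix_elementary_alt)
  case (1 A B)
  have [measurable]: "(*v) A \<in> borel_measurable borel" "g \<in> borel_measurable borel"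
    using 1 by (auto intro!: borel_measurable_continuous_onI matrix_vector_mult_linear_continuous_on)
  have "ennreal \<bar>det (A ** B)\<bar> * (\<integral>\<^sup>+x. g ((A ** B) *v x) \<partial>lborel) =
      ennreal \<bar>det A\<bar> * (ennreal \<bar>det B\<bar> * (\<integral>\<^sup>+x. g (A *v (B *v x)) \<partial>lborel))"
    by (simp add: det_mul abs_mult ennreal_mult mult.assoc matrix_vector_mul_assoc)
  also have "(ennreal \<bar>det B\<bar> * (\<integral>\<^sup>+x. g (A *v (B *v x)) \<partial>lborel)) = (\<integral>\<^sup>+x. g (A *v x) \<partial>lborel)"
    using 1 by (intro "1.IH") (auto simp: det_mul)
  also have "ennreal \<bar>det A\<bar> * (\<integral>\<^sup>+x. g (A *v x) \<partial>lborel) = (\<integral>\<^sup>+x. g x \<partial>lborel)"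
    using 1 by (intro "1.IH") (auto simp: det_mul)
  finally show ?case .
next
  case (2 A i)
  then show ?case by (metis det_zero_row(1))
next
  case (3 A)
  have nz: "A $ i $ i \<noteq> 0" for i
    using 3 by (auto simp: det_diagonal)
  \<comment> \<open>Brings a diagonal \<open>A\<close> into the coordinatewise form of
    \<open>lborel_affine_euclidean\<close>, with translation 0 and the diagonal entries as
    factors.\<close>
  have Ax: "A *v x = 0 + (\<Sum>j\<in>Basis. ((A *v j) \<bullet> j * (x \<bullet> j)) *\<^sub>R j)" for x
  proof -
    have "(A *v x) $ i = (\<Sum>j\<in>UNIV. if j = i then A $ i $ i * x $ i else 0)" for i
    proof -
      have "(\<Sum>j\<in>UNIV. A $ i $ j * x $ j) = (\<Sum>j\<in>UNIV. if j = i then A $ i $ i * x $ i else 0)"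
        using 3 by (intro sum.cong) auto
      then show ?thesis by (simp add: matrix_vector_mult_def)
    qed
    note Axi = this
    have "(A *v x) \<bullet> b = (\<Sum>j\<in>Basis. ((A *v j) \<bullet> j * (x \<bullet> j)) *\<^sub>R j) \<bullet> b" if b: "b \<in> Basis" for b
    proof -
      have "(\<Sum>j\<in>Basis. ((A *v j) \<bullet> j * (x \<bullet> j)) *\<^sub>R j) \<bullet> b = (A *v b) \<bullet> b * (x \<bullet> b)"
        using b by simp
      moreover obtain i where "b = axis i 1" using b by (auto simp: Basis_vec_def)
      ultimately show ?thesis
        using Axi[of i] by (simp only: inner_axis matrix_vector_mul_component inner_real_def) simp
    qed
    then show ?thesis by (simp add: euclidean_eq_iff[of "A *v x"])
  qed
  have "(A *v j) \<bullet> j \<noteq> 0" if "j \<in> Basis" for j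
    using nz that by (auto simp: Basis_vec_def inner_axis matrix_vector_mul_component)
  note aff = lborel_affine_euclidean[of "\<lambda>j. (A *v j) \<bullet> j" 0, OF this]
  have eq: "(\<lambda>x. 0 + (\<Sum>j\<in>Basis. ((A *v j) \<bullet> j * (x \<bullet> j)) *\<^sub>R j)) = (*v) A"
    by (rule ext) (rule Ax[symmetric])
  have "lborel = density (distr lborel borel ((*v) A)) (\<lambda>_. ennreal (\<Prod>j\<in>Basis. \<bar>(A *v j) \<bullet> j\<bar>))"
    by (rule aff[unfolded eq])
  also have "(\<Prod>j\<in>Basis. \<bar>(A *v j) \<bullet> j\<bar>) = \<bar>det A\<bar>"
    using 3 by (simp add: prod_Basis_cart inner_axis matrix_vector_mul_component det_diagonal abs_prod)
  finally have "(\<integral>\<^sup>+x. g x \<partial>lborel) = (\<integral>\<^sup>+x. g x \<partial>density (distr lborel borel ((*v) A)) (\<lambda>_. ennreal \<bar>det A\<bar>))"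
    by (rule arg_cong)
  also have "\<dots> = ennreal \<bar>det A\<bar> * (\<integral>\<^sup>+x. g (A *v x) \<partial>lborel)"
  proof -
    have [measurable]: "(*v) A \<in> borel_measurable borel" "g \<in> borel_measurable borel"
      using 3 by (auto intro!: borel_measurable_continuous_onI matrix_vector_mult_linear_continuous_on)
    show ?thesis by (simp add: nn_integral_density nn_integral_distr nn_integral_cmult)
  qed
  finally show ?case ..
next
  case (4 m n)
  let ?p = "Transposition.transpose m n"
  have p: "?p permutes UNIV" by (rule permutes_swap_id) auto
  have "det ((\<chi> i j. mat 1 $ i $ ?p j) :: real^'n^'n) = of_int (sign ?p)"
    using det_permute_columns[OF p, of "mat 1 :: real^'n^'n"] by simp
  then have "\<bar>det ((\<chi> i j. mat 1 $ i $ ?p j) :: real^'n^'n)\<bar> = 1"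
    using 4 by (simp add: sign_swap_id)
  moreover have "(\<chi> i j. mat 1 $ i $ ?p j) *v x = (\<chi> i. x $ ?p i)" for x :: "real^'n"
  proof -
    have "(\<Sum>j\<in>UNIV. (if i = ?p j then 1 else 0) * x $ j) = x $ ?p i" for i
    proof -
      have "(if i = ?p j then 1 else 0) * x $ j = (if j = ?p i then x $ ?p i else 0)" for j
        by (metis mult_1 mult_zero_left transpose_involutory)
      then show ?thesis by simp
    qed
    then show ?thesis by (simp add: matrix_vector_mult_def mat_def)
  qed
  ultimately show ?case using nn_integral_lborel_permute[OF p 4(3)] by simp
next
  case (5 m n)
  let ?A = "(\<chi> i j. of_bool (i = m \<and> j = n \<or> i = j)) :: real^'n^'n"
  have "?A = (\<chi> k. if k = m then row m (mat 1) + 1 *s row n (mat 1) else row k (mat 1))"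
    using 5 by (auto simp: vec_eq_iff row_def mat_def)
  then have "det ?A = 1" using det_row_operation[OF 5(1), of "mat 1 :: real^'n^'n" 1] by simp
  moreover have "?A *v x = x + (x \<bullet> axis n 1) *\<^sub>R axis m 1" for x
  proof -
    have "(\<Sum>j\<in>UNIV. of_bool (i = m \<and> j = n \<or> i = j) * x $ j) =
        (\<Sum>j\<in>UNIV. (if j = i then x $ i else 0) + (if j = n then of_bool (i = m) * x $ n else 0))" for i
      using 5(1) by (intro sum.cong) auto
    then show ?thesis
      by (simp add: matrix_vector_mult_def vec_eq_iff sum.distrib inner_axis) (auto simp: axis_def)
  qed
  ultimately show ?case
    using nn_integral_lborel_shear[of "axis n 1 :: real^'n" "axis m 1" g] 5
    by (auto simp: Basis_vec_def axis_eq_axis)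
qed

section \<open>The multivariate normal distribution\<close>

text \<open>A product over the basis, so that total mass and characteristic function factor into
  one-dimensional integrals.\<close>

definition std_gauss_density :: "'a::euclidean_space \<Rightarrow> real" where
  "std_gauss_density x = (\<Prod>b\<in>Basis. std_normal_density (x \<bullet> b))"

definition std_gauss :: "'a::euclidean_space measure" where
  "std_gauss = density lborel (\<lambda>x. ennreal (std_gauss_density x))"

lemma sets_std_gauss [simp, measurable_cong]: "sets std_gauss = sets borel"
  by (simp add: std_gauss_def)

lemma space_std_gauss [simp]: "space std_gauss = UNIV"
  by (simp add: std_gauss_def)

lemma std_gauss_density_measurable [measurable]: "std_gauss_density \<in> borel_measurable borel"
  unfolding std_gauss_density_def[abs_def] by measurable

lemma std_gauss_density_nonneg: "std_gauss_density x \<ge> 0"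
  by (simp add: std_gauss_density_def prod_nonneg)

lemma std_gauss_density_eq:
  fixes x :: "'a::euclidean_space"
  shows "std_gauss_density x = exp (- (x \<bullet> x) / 2) / sqrt ((2 * pi) ^ DIM('a))"
proof -
  have 1: "std_gauss_density x = (\<Prod>b\<in>(Basis::'a set). 1 / sqrt (2 * pi)) * (\<Prod>b\<in>Basis. exp (- (x \<bullet> b)\<^sup>2 / 2))"
    by (simp only: std_gauss_density_def std_normal_density_def prod.distrib)
  moreover have "(\<Prod>b\<in>Basis. exp (- (x \<bullet> b)\<^sup>2 / 2)) = exp (- (x \<bullet> x) / 2)"
    by (simp add: exp_sum[symmetric] euclidean_inner[of x x] power2_eq_square sum_negf
        sum_divide_distrib)
  moreover have "(\<Prod>b\<in>(Basis::'a set). 1 / sqrt (2 * pi)) = 1 / sqrt ((2 * pi) ^ DIM('a))"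
    by (simp only: prod_constant real_sqrt_power power_one_over)
  ultimately show ?thesis by (simp add: 1)
qed

lemma prob_space_std_gauss: "prob_space (std_gauss :: 'a::euclidean_space measure)"
proof
  have 1: "(\<integral>\<^sup>+x. ennreal (std_normal_density x) \<partial>lborel) = 1"
    using prob_space.emeasure_space_1[OF prob_space_normal_density[of 1 0]]
    by (simp add: emeasure_density)
  have "emeasure (std_gauss :: 'a measure) (space std_gauss)
      = (\<integral>\<^sup>+x. (\<Prod>b\<in>Basis. ennreal (std_normal_density ((x::'a) \<bullet> b))) \<partial>lborel)"
    by (simp add: std_gauss_def emeasure_density std_gauss_density_def prod_ennreal)
  also have "\<dots> = (\<Prod>b\<in>(Basis::'a set). (\<integral>\<^sup>+x. ennreal (std_normal_density x) \<partial>lborel))"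
    by (intro nn_integral_lborel_prod) auto
  finally show "emeasure (std_gauss :: 'a measure) (space std_gauss) = 1" by (simp add: 1)
qed

lemma iexp_integrable:
  assumes "finite_measure N" "f \<in> borel_measurable N"
  shows "integrable N (\<lambda>x. iexp (f x))"
  using assms by (intro finite_measure.integrable_const_bound[of _ _ 1]) auto

text \<open>Density and exponential both factor over the coordinates, so the integral is a product
  of characteristic functions of the one-dimensional standard normal law.\<close>

lemma char_std_gauss:
  fixes t :: "'a::euclidean_space"
  shows "(CLINT x|std_gauss. iexp (t \<bullet> x)) = complex_of_real (exp (- (t \<bullet> t) / 2))"
proof -
  interpret product_sigma_finite "\<lambda>_::'a. lborel :: real measure" ..
  have int: "integrable lborel (\<lambda>x. std_normal_density x *\<^sub>R iexp (c * x))" for c :: real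
  proof -
    have "integrable std_normal_distribution (\<lambda>x. iexp (c * x))"
      by (intro iexp_integrable prob_space.finite_measure prob_space_normal_density) auto
    then show ?thesis by (subst (asm) integrable_density) auto
  qed
  have char1: "(CLINT x|lborel. std_normal_density x *\<^sub>R iexp (c * x)) = exp (- c\<^sup>2 / 2)" for c :: real
    using fun_cong[OF char_std_normal_distribution, of c]
    by (simp add: char_def integral_density)
  have "(CLINT x|std_gauss. iexp (t \<bullet> x)) =
      (CLINT x|lborel. std_gauss_density x *\<^sub>R iexp (t \<bullet> x))"
    unfolding std_gauss_def by (intro integral_density) (auto simp: std_gauss_density_nonneg)
  also have "\<dots> = (CLINT f|(\<Pi>\<^sub>M b\<in>Basis. lborel).
      (\<Prod>b\<in>Basis. std_normal_density (f b) *\<^sub>R iexp ((t \<bullet> b) * f b)))"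
  proof -
    have *: "std_gauss_density (\<Sum>b\<in>Basis. f b *\<^sub>R b) *\<^sub>R iexp (t \<bullet> (\<Sum>b\<in>Basis. f b *\<^sub>R b)) =
        (\<Prod>b\<in>Basis. std_normal_density (f b) *\<^sub>R iexp ((t \<bullet> b) * f b))" for f
    proof -
      have "t \<bullet> (\<Sum>b\<in>Basis. f b *\<^sub>R b) = (\<Sum>b\<in>Basis. (t \<bullet> b) * f b)"
        by (simp add: inner_sum_right mult.commute)
      then have "iexp (t \<bullet> (\<Sum>b\<in>Basis. f b *\<^sub>R b)) = (\<Prod>b\<in>Basis. iexp ((t \<bullet> b) * f b))"
        by (simp add: exp_sum[symmetric] sum_distrib_left)
      moreover have "std_gauss_density (\<Sum>b\<in>Basis. f b *\<^sub>R b :: 'a) = (\<Prod>b\<in>Basis. std_normal_density (f b))"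
        by (simp add: std_gauss_density_def)
      ultimately show ?thesis
        by (simp only: scaleR_conv_of_real of_real_prod prod.distrib)
    qed
    have "(CLINT x|lborel. std_gauss_density x *\<^sub>R iexp (t \<bullet> x)) =
        (CLINT f|(\<Pi>\<^sub>M b\<in>Basis. lborel). std_gauss_density (\<Sum>b\<in>Basis. f b *\<^sub>R b) *\<^sub>R
          iexp (t \<bullet> (\<Sum>b\<in>Basis. f b *\<^sub>R b)))"
      by (subst lborel_eq, subst integral_distr) (auto simp del: inner_sum_left inner_sum_right)
    then show ?thesis by (simp only: *)
  qed
  also have "\<dots> = (\<Prod>b\<in>Basis. (CLINT x|lborel. std_normal_density x *\<^sub>R iexp ((t \<bullet> b) * x)))"
    by (intro product_integral_prod int) auto
  also have "\<dots> = (\<Prod>b\<in>Basis. complex_of_real (exp (- (t \<bullet> b)\<^sup>2 / 2)))"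
    by (simp only: char1)
  also have "\<dots> = complex_of_real (\<Prod>b\<in>Basis. exp (- (t \<bullet> b)\<^sup>2 / 2))"
    by simp
  also have "(\<Prod>b\<in>Basis. exp (- (t \<bullet> b)\<^sup>2 / 2)) = exp (- (t \<bullet> t) / 2)"
    by (simp add: exp_sum[symmetric] euclidean_inner[of t t] power2_eq_square sum_negf
        sum_divide_distrib)
  finally show ?thesis .
qed

lemma sets_mvnormal [simp, measurable_cong]: "sets (mvnormal \<mu> V) = sets borel"
  by (simp add: mvnormal_def)

lemma space_mvnormal [simp]: "space (mvnormal \<mu> V) = UNIV"
  by (simp add: mvnormal_def)

lemma mvn_density_measurable [measurable]: "mvn_density \<mu> V \<in> borel_measurable borel"
proof -
  have "(\<lambda>x. matrix_inv V *v (x - \<mu>)) \<in> borel_measurable borel"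
    by (intro borel_measurable_continuous_onI continuous_intros matrix_vector_mult_linear_continuous_on
        continuous_on_compose2[OF matrix_vector_mult_linear_continuous_on]) auto
  then show ?thesis unfolding mvn_density_def[abs_def] by measurable
qed

lemma matrix_vector_mult_measurable [measurable]:
  "(*v) (A :: real^'n^'m) \<in> borel_measurable borel"
  by (intro borel_measurable_continuous_onI matrix_vector_mult_linear_continuous_on)

text \<open>Substituting \<open>S *v x\<close> turns the exponent into that of the standard density,
  and the root of \<open>det (S ** transpose S)\<close> is \<open>\<bar>det S\<bar>\<close>, which
  cancels against the Jacobian.\<close>

lemma mvnormal_linear_image:
  fixes S :: "real^'n^'n"
  assumes S: "invertible S"
  shows "mvnormal 0 (S ** transpose S) = distr std_gauss borel ((*v) S)"
proof (rule measure_eqI)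
  fix A assume "A \<in> sets (mvnormal 0 (S ** transpose S))"
  then have [measurable]: "A \<in> sets borel" by simp
  let ?V = "S ** transpose S"
  have dens: "\<bar>det S\<bar> * mvn_density 0 ?V (S *v x) = std_gauss_density x" for x
  proof -
    have "matrix_inv ?V *v (S *v x) = transpose (matrix_inv S) *v x"
      using S by (simp add: matrix_inv_gram matrix_vector_mul_assoc matrix_mul_assoc[symmetric]
          matrix_inv_mult)
    then have "(S *v x) \<bullet> (matrix_inv ?V *v (S *v x)) = x \<bullet> x"
      using S by (simp add: inner_commute[of "S *v x"] dot_lmul_matrix
          matrix_vector_mul_assoc matrix_inv_mult)
    moreover have "sqrt ((2 * pi) ^ CARD('n) * det ?V) = sqrt ((2 * pi) ^ CARD('n)) * \<bar>det S\<bar>"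
      by (simp add: det_mul real_sqrt_mult)
    ultimately show ?thesis
      using S by (simp add: mvn_density_def std_gauss_density_eq invertible_det_nz)
  qed
  have "emeasure (mvnormal 0 ?V) A = (\<integral>\<^sup>+x. ennreal (mvn_density 0 ?V x) * indicator A x \<partial>lborel)"
    by (simp add: mvnormal_def emeasure_density)
  also have "\<dots> = ennreal \<bar>det S\<bar> * (\<integral>\<^sup>+x. ennreal (mvn_density 0 ?V (S *v x)) * indicator A (S *v x) \<partial>lborel)"
    using S by (intro nn_integral_lborel_linear[symmetric]) (auto simp: invertible_det_nz)
  also have "\<dots> = (\<integral>\<^sup>+x. ennreal (std_gauss_density x) * indicator A (S *v x) \<partial>lborel)"
    by (subst nn_integral_cmult[symmetric])
      (auto simp: dens[symmetric] ennreal_mult' mult.assoc intro!: nn_integral_cong)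
  also have "\<dots> = (\<integral>\<^sup>+x. ennreal (std_gauss_density x) * indicator ((*v) S -` A) x \<partial>lborel)"
    by (simp add: indicator_def)
  also have "\<dots> = emeasure (distr std_gauss borel ((*v) S)) A"
    using measurable_sets[OF matrix_vector_mult_measurable, of A S]
    by (simp add: emeasure_distr std_gauss_def emeasure_density)
  finally show "emeasure (mvnormal 0 ?V) A = emeasure (distr std_gauss borel ((*v) S)) A" .
qed simp

lemma prob_space_mvnormal:
  fixes V :: "real^'n^'n"
  assumes "pos_def V" shows "prob_space (mvnormal 0 V)"
proof -
  obtain S :: "real^'n^'n" where S: "V = S ** transpose S" "invertible S"
    using pos_def_decomposition[OF assms] .
  then show ?thesis
    by (simp add: mvnormal_linear_image prob_space.prob_space_distr prob_space_std_gauss)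
qed

lemma char_mvnormal:
  fixes V :: "real^'n^'n"
  assumes "pos_def V"
  shows "(CLINT x|mvnormal 0 V. iexp (t \<bullet> x)) = complex_of_real (exp (- (t \<bullet> (V *v t)) / 2))"
proof -
  obtain S :: "real^'n^'n" where S: "V = S ** transpose S" "invertible S"
    using pos_def_decomposition[OF assms] .
  have "(CLINT x|mvnormal 0 V. iexp (t \<bullet> x)) = (CLINT x|std_gauss. iexp ((transpose S *v t) \<bullet> x))"
    by (simp add: S mvnormal_linear_image integral_distr dot_lmul_matrix)
  also have "\<dots> = complex_of_real (exp (- (t \<bullet> (V *v t)) / 2))"
    unfolding char_std_gauss by (simp add: S dot_lmul_matrix matrix_vector_mul_assoc[symmetric])
  finally show ?thesis .
qed

section \<open>Uniqueness of characteristic functions\<close>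

text \<open>Closed sets form a generator stable under intersection, and the indicator of a closed
  set is the pointwise limit of the continuous functions \<open>f m\<close>, which fall off at slope
  \<open>m\<close> with the distance from the set.\<close>

lemma prob_eqI_bounded_continuous:
  fixes N N' :: "'a::metric_space measure"
  assumes "prob_space N" "prob_space N'" "sets N = sets borel" "sets N' = sets borel"
    and eq: "\<And>f::'a \<Rightarrow> real. continuous_on UNIV f \<Longrightarrow> (\<And>x. 0 \<le> f x \<and> f x \<le> 1) \<Longrightarrow>
      (\<integral>\<^sup>+x. ennreal (f x) \<partial>N) = (\<integral>\<^sup>+x. ennreal (f x) \<partial>N')"
  shows "N = N'"
proof (rule measure_eqI_generator_eq[of "Collect closed" UNIV _ _ "\<lambda>_. UNIV"])
  fix A :: "'a set" assume "A \<in> Collect closed"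
  then have "closed A" by simp
  show "emeasure N A = emeasure N' A"
  \<comment> \<open>\<open>infdist\<close> to the empty set is 0 by convention, so the approximation
    below would give the constant 1.\<close>
  proof (cases "A = {}")
    case False
    define f where "f m x = max 0 (1 - real m * infdist x A)" for m x
    have lim: "(\<lambda>m. \<integral>\<^sup>+x. ennreal (f m x) \<partial>L) \<longlonglongrightarrow> emeasure L A"
      if "prob_space L" "sets L = sets borel" for L
    proof -
      have "A \<in> sets L" using \<open>closed A\<close> that by auto
      moreover have "(\<lambda>m. \<integral>\<^sup>+x. ennreal (f m x) \<partial>L) \<longlonglongrightarrow> (\<integral>\<^sup>+x. indicator A x \<partial>L)"
      proof (rule nn_integral_dominated_convergence[where w="\<lambda>_. 1"])
        show "(\<lambda>x. ennreal (f m x)) \<in> borel_measurable L" for m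
          unfolding f_def measurable_cong_sets[OF that(2) refl]
          by (intro measurable_compose[OF _ measurable_ennreal] borel_measurable_continuous_onI continuous_intros)
        show "indicator A \<in> borel_measurable L" using \<open>A \<in> sets L\<close> by simp
        show "(\<integral>\<^sup>+x. 1 \<partial>L) < \<infinity>" using prob_space.emeasure_space_1[OF that(1)] by simp
        show "AE x in L. ennreal (f m x) \<le> 1" for m
          by (auto simp: f_def ennreal_le_1 infdist_nonneg)
        show "AE x in L. (\<lambda>m. ennreal (f m x)) \<longlonglongrightarrow> indicator A x"
        proof (rule AE_I2)
          fix x
          show "(\<lambda>m. ennreal (f m x)) \<longlonglongrightarrow> indicator A x"
          proof (cases "x \<in> A")
            case True
            then show ?thesis by (simp add: f_def)
          next
            case nA: False
            then have pos: "infdist x A > 0"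
              using in_closed_iff_infdist_zero[OF \<open>closed A\<close> \<open>A \<noteq> {}\<close>, of x] infdist_nonneg[of x A]
              by (simp add: less_le)
            obtain m0 where m0: "real m0 * infdist x A > 1"
              using reals_Archimedean3[OF pos] by blast
            have "\<forall>\<^sub>F m in sequentially. ennreal (f m x) = 0"
              using eventually_ge_at_top[of m0]
            proof eventually_elim
              case (elim m)
              then have "real m0 * infdist x A \<le> real m * infdist x A"
                using pos by (intro mult_right_mono) auto
              with m0 show ?case by (simp add: f_def)
            qed
            then show ?thesis using nA by (simp add: tendsto_eventually)
          qed
        qed
      qed simp
      ultimately show ?thesis by simp
    qed
    have "(\<integral>\<^sup>+x. ennreal (f m x) \<partial>N) = (\<integral>\<^sup>+x. ennreal (f m x) \<partial>N')" for m
      unfolding f_def by (intro eq continuous_intros) (auto simp: infdist_nonneg)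
    then show ?thesis
      using lim[OF assms(1,3)] lim[OF assms(2,4)] by (simp add: LIMSEQ_unique)
  qed simp
next
  have "sets (borel::'a measure) = sigma_sets UNIV (Collect closed)"
    by (subst borel_eq_closed) (rule sets_measure_of, simp)
  then show "sets N = sigma_sets UNIV (Collect closed)" "sets N' = sigma_sets UNIV (Collect closed)"
    using assms by simp_all
  show "emeasure N UNIV \<noteq> \<infinity>"
    using finite_measure.emeasure_finite[OF prob_space.finite_measure[OF assms(1)]] by simp
qed (auto simp: Int_stable_def)

lemma nn_integral_lborel_affine:
  fixes t :: "'a::euclidean_space"
  assumes "c > 0" and [measurable]: "g \<in> borel_measurable borel"
  shows "(\<integral>\<^sup>+x. g x \<partial>lborel) = ennreal (c ^ DIM('a)) * (\<integral>\<^sup>+x. g (t + c *\<^sub>R x) \<partial>lborel)"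
  using assms(1)
  by (subst lborel_affine[of c t])
     (simp_all add: nn_integral_density nn_integral_distr nn_integral_cmult)

text \<open>Adding independent Gaussian noise of scale \<open>\<sigma>\<close> produces a density;
  on the right, \<open>N\<close> occurs only through the average of the Gaussian kernel.\<close>

lemma nn_integral_gauss_convolution:
  fixes N :: "'a::euclidean_space measure"
  assumes "prob_space N" and sets [simp, measurable_cong]: "sets N = sets borel"
    and \<sigma>: "\<sigma> > 0" and [measurable]: "f \<in> borel_measurable borel"
  shows "(\<integral>\<^sup>+x. (\<integral>\<^sup>+z. f (x + \<sigma> *\<^sub>R z) \<partial>std_gauss) \<partial>N) = 
    ennreal ((1 / \<sigma>) ^ DIM('a)) * (\<integral>\<^sup>+y. f y * (\<integral>\<^sup>+x. ennreal (std_gauss_density ((y - x) /\<^sub>R \<sigma>)) \<partial>N) \<partial>lborel)"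
proof -
  interpret N: prob_space N by fact
  interpret pair_sigma_finite N "lborel :: 'a measure" ..
  have inner: "(\<integral>\<^sup>+z. f (x + \<sigma> *\<^sub>R z) \<partial>std_gauss) = 
      ennreal ((1 / \<sigma>) ^ DIM('a)) * (\<integral>\<^sup>+y. f y * ennreal (std_gauss_density ((y - x) /\<^sub>R \<sigma>)) \<partial>lborel)" for x
  proof -
    have "(\<integral>\<^sup>+y. f y * ennreal (std_gauss_density ((y - x) /\<^sub>R \<sigma>)) \<partial>lborel) =
        ennreal (\<sigma> ^ DIM('a)) * (\<integral>\<^sup>+z. f (x + \<sigma> *\<^sub>R z) * ennreal (std_gauss_density z) \<partial>lborel)"
      using \<sigma> by (subst nn_integral_lborel_affine[OF \<sigma>, of _ x]) auto
    moreover have "ennreal ((1 / \<sigma>) ^ DIM('a)) * ennreal (\<sigma> ^ DIM('a)) = 1"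
      using \<sigma> by (simp add: ennreal_mult[symmetric] power_mult_distrib[symmetric])
    ultimately show ?thesis
      by (simp add: std_gauss_def nn_integral_density mult.assoc[symmetric]) (simp add: mult.commute)
  qed
  have "(\<integral>\<^sup>+x. (\<integral>\<^sup>+z. f (x + \<sigma> *\<^sub>R z) \<partial>std_gauss) \<partial>N) =
      ennreal ((1 / \<sigma>) ^ DIM('a)) * (\<integral>\<^sup>+x. (\<integral>\<^sup>+y. f y * ennreal (std_gauss_density ((y - x) /\<^sub>R \<sigma>)) \<partial>lborel) \<partial>N)"
    unfolding inner by (intro nn_integral_cmult) measurable
  also have "(\<integral>\<^sup>+x. (\<integral>\<^sup>+y. f y * ennreal (std_gauss_density ((y - x) /\<^sub>R \<sigma>)) \<partial>lborel) \<partial>N) =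
      (\<integral>\<^sup>+y. (\<integral>\<^sup>+x. f y * ennreal (std_gauss_density ((y - x) /\<^sub>R \<sigma>)) \<partial>N) \<partial>lborel)"
    by (intro Fubini'[symmetric]) measurable
  also have "\<dots> = (\<integral>\<^sup>+y. f y * (\<integral>\<^sup>+x. ennreal (std_gauss_density ((y - x) /\<^sub>R \<sigma>)) \<partial>N) \<partial>lborel)"
    by (intro nn_integral_cong nn_integral_cmult) measurable
  finally show ?thesis .
qed

text \<open>Expresses that kernel average through the characteristic function of \<open>N\<close>,
  by writing the kernel as a Fourier integral and exchanging the integrals.\<close>

lemma gauss_convolution_density_char:
  fixes N :: "'a::euclidean_space measure"
  assumes "prob_space N" and sets [simp, measurable_cong]: "sets N = sets borel"
  shows "complex_of_real (\<integral>x. std_gauss_density ((y - x) /\<^sub>R \<sigma>) \<partial>N) =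
    complex_of_real (1 / sqrt ((2 * pi) ^ DIM('a))) *
    (CLINT z|std_gauss. iexp ((y /\<^sub>R \<sigma>) \<bullet> z) * (CLINT x|N. iexp ((- z /\<^sub>R \<sigma>) \<bullet> x)))"
proof -
  interpret N: prob_space N by fact
  interpret G: prob_space "std_gauss :: 'a measure" by (rule prob_space_std_gauss)
  interpret P: pair_prob_space N "std_gauss :: 'a measure" ..
  let ?c = "complex_of_real (1 / sqrt ((2 * pi) ^ DIM('a)))"
  \<comment> \<open>Up to a constant the Gaussian density is its own characteristic
    function.\<close>
  have gd: "complex_of_real (std_gauss_density u) = ?c * (CLINT z|std_gauss. iexp (u \<bullet> z))" for u :: 'a
    by (simp add: char_std_gauss std_gauss_density_eq)
  have "complex_of_real (\<integral>x. std_gauss_density ((y - x) /\<^sub>R \<sigma>) \<partial>N) =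
      (CLINT x|N. ?c * (CLINT z|std_gauss. iexp (((y - x) /\<^sub>R \<sigma>) \<bullet> z)))"
    by (simp only: integral_complex_of_real[symmetric] gd)
  also have "\<dots> = ?c * (CLINT x|N. (CLINT z|std_gauss. iexp (((y - x) /\<^sub>R \<sigma>) \<bullet> z)))"
    by (rule integral_mult_right_zero)
  also have "(CLINT x|N. (CLINT z|std_gauss. iexp (((y - x) /\<^sub>R \<sigma>) \<bullet> z))) =
      (CLINT z|std_gauss. (CLINT x|N. iexp (((y - x) /\<^sub>R \<sigma>) \<bullet> z)))"
  proof (rule P.Fubini_integral[symmetric])
    show "integrable (N \<Otimes>\<^sub>M std_gauss) (\<lambda>(x, z). iexp (((y - x) /\<^sub>R \<sigma>) \<bullet> z))"
      using iexp_integrable[OF P.finite_measure_axioms, of "\<lambda>(x, z). ((y - x) /\<^sub>R \<sigma>) \<bullet> z"]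
      by (simp add: case_prod_beta')
  qed
  also have "\<dots> = (CLINT z|std_gauss. iexp ((y /\<^sub>R \<sigma>) \<bullet> z) * (CLINT x|N. iexp ((- z /\<^sub>R \<sigma>) \<bullet> x)))"
  proof (rule Bochner_Integration.integral_cong[OF refl])
    fix z :: 'a
    have "iexp (((y - x) /\<^sub>R \<sigma>) \<bullet> z) = iexp ((y /\<^sub>R \<sigma>) \<bullet> z) * iexp ((- z /\<^sub>R \<sigma>) \<bullet> x)" for x
      by (simp add: exp_add[symmetric] inner_diff_left right_diff_distrib inner_commute[of z] algebra_simps)
    then show "(CLINT x|N. iexp (((y - x) /\<^sub>R \<sigma>) \<bullet> z)) =
        iexp ((y /\<^sub>R \<sigma>) \<bullet> z) * (CLINT x|N. iexp ((- z /\<^sub>R \<sigma>) \<bullet> x))"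
      by simp
  qed
  finally show ?thesis .
qed

lemma std_gauss_density_le: "std_gauss_density (x::'a::euclidean_space) \<le> 1 / sqrt ((2 * pi) ^ DIM('a))"
  by (simp add: std_gauss_density_eq divide_right_mono)

text \<open>Convolution with a small Gaussian gives a density that depends only on the characteristic
  function.\<close>

lemma char_fun_unique:
  fixes N N' :: "'a::euclidean_space measure"
  assumes N: "prob_space N" "sets N = sets borel" and N': "prob_space N'" "sets N' = sets borel"
    and char: "\<And>t. (CLINT x|N. iexp (t \<bullet> x)) = (CLINT x|N'. iexp (t \<bullet> x))"
  shows "N = N'"
proof (rule prob_eqI_bounded_continuous[OF N(1) N'(1) N(2) N'(2)])
  fix f :: "'a \<Rightarrow> real"
  assume f: "continuous_on UNIV f" "\<And>x. 0 \<le> f x \<and> f x \<le> 1"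
  then have fm [measurable]: "f \<in> borel_measurable borel"
    by (intro borel_measurable_continuous_onI)
  let ?I = "\<lambda>L \<sigma>. \<integral>\<^sup>+x. (\<integral>\<^sup>+z. ennreal (f (x + \<sigma> *\<^sub>R z)) \<partial>std_gauss) \<partial>L"
  interpret G: prob_space "std_gauss :: 'a measure" by (rule prob_space_std_gauss)
  \<comment> \<open>The smoothing disappears as its scale \<open>1 / Suc m\<close> tends to 0:
    dominated convergence in the noise for fixed \<open>x\<close>, then in \<open>x\<close>.\<close>
  have lim: "(\<lambda>m. ?I L (1 / Suc m)) \<longlonglongrightarrow> (\<integral>\<^sup>+x. ennreal (f x) \<partial>L)"
    if L: "prob_space L" "sets L = sets borel" for L
  proof (rule nn_integral_dominated_convergence[where w="\<lambda>_. 1"])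
    interpret L: prob_space L by fact
    note L(2)[measurable_cong]
    show "(\<lambda>x. \<integral>\<^sup>+z. ennreal (f (x + (1 / Suc m) *\<^sub>R z)) \<partial>std_gauss) \<in> borel_measurable L" for m
      by measurable
    show "(\<lambda>x. ennreal (f x)) \<in> borel_measurable L" by measurable
    show "(\<integral>\<^sup>+x. 1 \<partial>L) < \<infinity>" using L.emeasure_space_1 by simp
    show "(\<lambda>_. 1) \<in> borel_measurable L" by simp
    show "AE x in L. (\<integral>\<^sup>+z. ennreal (f (x + (1 / Suc m) *\<^sub>R z)) \<partial>std_gauss) \<le> 1" for m
    proof (rule AE_I2)
      fix x
      have "(\<integral>\<^sup>+z. ennreal (f (x + (1 / Suc m) *\<^sub>R z)) \<partial>std_gauss) \<le> (\<integral>\<^sup>+(z::'a). 1 \<partial>std_gauss)"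
        using f(2) by (intro nn_integral_mono) auto
      then show "(\<integral>\<^sup>+z. ennreal (f (x + (1 / Suc m) *\<^sub>R z)) \<partial>std_gauss) \<le> 1"
        using G.emeasure_space_1 by simp
    qed
    show "AE x in L. (\<lambda>m. \<integral>\<^sup>+z. ennreal (f (x + (1 / Suc m) *\<^sub>R z)) \<partial>std_gauss) \<longlonglongrightarrow> ennreal (f x)"
    proof (rule AE_I2)
      fix x
      have "(\<lambda>m. \<integral>\<^sup>+z. ennreal (f (x + (1 / Suc m) *\<^sub>R z)) \<partial>std_gauss) \<longlonglongrightarrow>
          (\<integral>\<^sup>+(z::'a). ennreal (f x) \<partial>std_gauss)"
      proof (rule nn_integral_dominated_convergence[where w="\<lambda>_. 1"])
        show "(\<integral>\<^sup>+(x::'a). 1 \<partial>std_gauss) < \<infinity>" using G.emeasure_space_1 by simp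
        show "AE z in std_gauss. (\<lambda>m. ennreal (f (x + (1 / Suc m) *\<^sub>R z))) \<longlonglongrightarrow> ennreal (f x)"
        proof (rule AE_I2)
          fix z :: 'a
          have "(\<lambda>m. x + (1 / Suc m) *\<^sub>R z) \<longlonglongrightarrow> x + 0 *\<^sub>R z"
            using LIMSEQ_inverse_real_of_nat by (intro tendsto_intros) (simp add: inverse_eq_divide)
          then have "(\<lambda>m. f (x + (1 / Suc m) *\<^sub>R z)) \<longlonglongrightarrow> f x"
            using f(1) by (intro continuous_on_tendsto_compose[OF f(1)]) auto
          then show "(\<lambda>m. ennreal (f (x + (1 / Suc m) *\<^sub>R z))) \<longlonglongrightarrow> ennreal (f x)"
            by (rule tendsto_ennrealI)
        qed
      qed (use f(2) in auto)
      then show "(\<lambda>m. \<integral>\<^sup>+z. ennreal (f (x + (1 / Suc m) *\<^sub>R z)) \<partial>std_gauss) \<longlonglongrightarrow> ennreal (f x)"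
        using G.emeasure_space_1 by simp
    qed
  qed
  have nn: "(\<integral>\<^sup>+x. ennreal (std_gauss_density ((y - x) /\<^sub>R \<sigma>)) \<partial>L) =
      ennreal (\<integral>x. std_gauss_density ((y - x) /\<^sub>R \<sigma>) \<partial>L)"
    if L: "prob_space L" "sets L = sets borel" for L \<sigma> and y :: 'a
  proof (rule nn_integral_eq_integral)
    interpret L: prob_space L by fact
    note L(2)[measurable_cong]
    show "integrable L (\<lambda>x. std_gauss_density ((y - x) /\<^sub>R \<sigma>))"
      by (rule L.integrable_const_bound[where B="1 / sqrt ((2 * pi) ^ DIM('a))"])
        (simp_all only: real_norm_def abs_of_nonneg[OF std_gauss_density_nonneg] std_gauss_density_le
          AE_I2, measurable)
  qed (simp add: std_gauss_density_nonneg)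
  \<comment> \<open>The only place where equality of the characteristic functions is used.\<close>
  have dens: "(\<integral>x. std_gauss_density ((y - x) /\<^sub>R \<sigma>) \<partial>N) = (\<integral>x. std_gauss_density ((y - x) /\<^sub>R \<sigma>) \<partial>N')" for \<sigma> y
  proof -
    have "complex_of_real (\<integral>x. std_gauss_density ((y - x) /\<^sub>R \<sigma>) \<partial>N) =
        complex_of_real (\<integral>x. std_gauss_density ((y - x) /\<^sub>R \<sigma>) \<partial>N')"
      unfolding gauss_convolution_density_char[OF N] gauss_convolution_density_char[OF N'] char ..
    then show ?thesis by simp
  qed
  have "?I N (1 / Suc m) = ?I N' (1 / Suc m)" for m
  proof -
    have pos: "1 / real (Suc m) > 0" by simp
    have "(\<lambda>x. ennreal (f x)) \<in> borel_measurable borel" by measurable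
    note conv = nn_integral_gauss_convolution[OF N pos this] nn_integral_gauss_convolution[OF N' pos this]
    show ?thesis unfolding conv nn[OF N] nn[OF N'] dens ..
  qed
  then show "(\<integral>\<^sup>+x. ennreal (f x) \<partial>N) = (\<integral>\<^sup>+x. ennreal (f x) \<partial>N')"
    using lim[OF N] lim[OF N'] by (simp add: LIMSEQ_unique)
qed

section \<open>The law of linear combinations of the errors\<close>

lemma measurable_vec_lambda [measurable (raw)]:
  fixes f :: "'n::finite \<Rightarrow> 'w \<Rightarrow> 'b::euclidean_space"
  assumes "\<And>i. f i \<in> borel_measurable M"
  shows "(\<lambda>\<omega>. \<chi> i. f i \<omega>) \<in> borel_measurable M"
proof (rule borel_measurable_euclidean_space[THEN iffD2], intro ballI)
  fix b :: "'b^'n" assume "b \<in> Basis"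
  then obtain i u where "b = axis i u" by (auto simp: Basis_vec_def)
  then show "(\<lambda>\<omega>. (\<chi> i. f i \<omega>) \<bullet> b) \<in> borel_measurable M"
    using assms by (simp add: inner_axis)
qed

lemma measurable_vec_nth [measurable (raw)]:
  fixes f :: "'w \<Rightarrow> ('b::euclidean_space)^'n"
  assumes "f \<in> borel_measurable M"
  shows "(\<lambda>\<omega>. f \<omega> $ i) \<in> borel_measurable M"
proof -
  have "continuous_on UNIV (\<lambda>x::'b^'n. x $ i)" by (intro continuous_intros)
  then show ?thesis
    using assms borel_measurable_continuous_onI measurable_compose by blast
qed

lemma measurable_transp_mult:
  assumes "\<And>i. i < n \<Longrightarrow> (\<lambda>\<omega>. E \<omega> i) \<in> borel_measurable M"
  shows "(\<lambda>\<omega>. transp_mult n a (E \<omega>)) \<in> borel_measurable M"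
  unfolding transp_mult_def
  by (intro measurable_vec_lambda borel_measurable_sum borel_measurable_times borel_measurable_const
      measurable_vec_nth assms) auto

lemma measurable_matrix_mult:
  fixes f :: "'w \<Rightarrow> real^'q^'p" and P :: "real^'p^'m"
  assumes "f \<in> borel_measurable M"
  shows "(\<lambda>\<omega>. P ** f \<omega>) \<in> borel_measurable M"
  unfolding matrix_matrix_mult_def
  by (intro measurable_vec_lambda borel_measurable_sum borel_measurable_times borel_measurable_const
      measurable_vec_nth assms)

lemma measurable_vec_cols:
  assumes "f \<in> borel_measurable M"
  shows "(\<lambda>\<omega>. vec_cols (f \<omega>)) \<in> borel_measurable M"
  unfolding vec_cols_def by (intro measurable_vec_lambda measurable_vec_nth assms)

lemma transp_mult_linear: "transp_mult n (\<lambda>i. P *v Z i) E = P ** transp_mult n Z E"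
proof -
  have "(\<Sum>i<n. (\<Sum>l\<in>UNIV. P $ j $ l * Z i $ l) * E i $ k) = 
      (\<Sum>l\<in>UNIV. P $ j $ l * (\<Sum>i<n. Z i $ l * E i $ k))" for j k
    unfolding sum_distrib_left sum_distrib_right by (subst sum.swap) (simp add: mult.assoc)
  then show ?thesis
    by (simp add: transp_mult_def matrix_matrix_mult_def matrix_vector_mult_def vec_eq_iff)
qed

lemma transpose_transp_mult: "transpose (transp_mult n U V) = transp_mult n V U"
  by (simp add: transp_mult_def transpose_def vec_eq_iff mult.commute)

lemma sum_UNIV_Times:
  "(\<Sum>x\<in>UNIV. f (x :: 'a::finite \<times> 'b::finite)) = (\<Sum>i\<in>UNIV. \<Sum>j\<in>UNIV. f (i, j))"
  by (simp add: sum.cartesian_product)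

text \<open>Read \<open>t\<close> as a matrix with rows indexed by \<open>'q\<close>. The form
  becomes the sum of the variances of the inner products of the errors with the images of the
  \<open>a i\<close> under that matrix, which makes it the exponent of a product of normal
  characteristic functions.\<close>

lemma inner_kronecker_gram:
  fixes a :: "nat \<Rightarrow> real^'p" and \<Sigma> :: "real^'q^'q"
  shows "t \<bullet> (kronecker \<Sigma> (transp_mult n a a) *v t) =
    (\<Sum>i<n. ((\<chi> k j. t $ (k, j)) *v a i) \<bullet> (\<Sigma> *v ((\<chi> k j. t $ (k, j)) *v a i)))"
proof -
  have "t \<bullet> (kronecker \<Sigma> (transp_mult n a a) *v t) =
      (\<Sum>k\<in>UNIV. \<Sum>j\<in>UNIV. \<Sum>l\<in>UNIV. \<Sum>m\<in>UNIV.
        \<Sum>i<n. \<Sigma> $ k $ l * (t $ (k, j) * a i $ j) * (t $ (l, m) * a i $ m))"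
    by (simp add: inner_matrix_vector_sum kronecker_def transp_mult_def sum_UNIV_Times
        sum_distrib_left sum_distrib_right mult_ac)
  also have "\<dots> = (\<Sum>i<n. \<Sum>k\<in>UNIV. \<Sum>l\<in>UNIV. \<Sum>j\<in>UNIV. \<Sum>m\<in>UNIV.
        \<Sigma> $ k $ l * (t $ (k, j) * a i $ j) * (t $ (l, m) * a i $ m))"
    \<comment> \<open>Four swaps move the observation index outwards past the coordinate indices;
      the last one exchanges the two middle coordinates.\<close>
    by (subst sum.swap[of _ "{..<n}"], subst sum.swap[of _ "{..<n}"], subst sum.swap[of _ "{..<n}"],
        subst sum.swap[of _ "{..<n}"], intro sum.cong refl, subst sum.swap, rule refl)
  also have "\<dots> = (\<Sum>i<n. ((\<chi> k j. t $ (k, j)) *v a i) \<bullet> (\<Sigma> *v ((\<chi> k j. t $ (k, j)) *v a i)))"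
    unfolding inner_matrix_vector_sum
    by (simp add: matrix_vector_mult_def sum_product sum_distrib_left mult_ac)
  finally show ?thesis .
qed

lemma inner_vec_cols_transp_mult:
  fixes a :: "nat \<Rightarrow> real^'p" and E :: "nat \<Rightarrow> real^'q"
  shows "t \<bullet> vec_cols (transp_mult n a E) = (\<Sum>i<n. ((\<chi> k j. t $ (k, j)) *v a i) \<bullet> E i)"
proof -
  have "t \<bullet> vec_cols (transp_mult n a E) =
      (\<Sum>k\<in>UNIV. \<Sum>j\<in>UNIV. \<Sum>i<n. t $ (k, j) * a i $ j * E i $ k)"
    by (simp add: inner_vec_def vec_cols_def transp_mult_def sum_UNIV_Times
        sum_distrib_left mult_ac)
  also have "\<dots> = (\<Sum>i<n. \<Sum>k\<in>UNIV. \<Sum>j\<in>UNIV. t $ (k, j) * a i $ j * E i $ k)"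
    by (subst sum.swap[of _ "{..<n}"], subst sum.swap[of _ "{..<n}"], rule refl)
  also have "\<dots> = (\<Sum>i<n. ((\<chi> k j. t $ (k, j)) *v a i) \<bullet> E i)"
    by (simp add: inner_vec_def matrix_vector_mult_def sum_distrib_right)
  finally show ?thesis .
qed

text \<open>By independence the characteristic function at \<open>t\<close> is the product of those
  of the rows at \<open>u i\<close>, and \<open>inner_kronecker_gram\<close> collects the exponents;
  uniqueness identifies the law.\<close>

lemma (in prob_space) distr_vec_cols_transp_mult:
  fixes a :: "nat \<Rightarrow> real^'p" and \<Sigma> :: "real^'q^'q" and E :: "'a \<Rightarrow> nat \<Rightarrow> real^'q"
  assumes \<Sigma>: "pos_def \<Sigma>" and a: "pos_def (transp_mult n a a)"
    and indep: "indep_vars (\<lambda>_. borel) (\<lambda>i \<omega>. E \<omega> i) {..<n}"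
    and normal: "\<And>i. i < n \<Longrightarrow> distr M borel (\<lambda>\<omega>. E \<omega> i) = mvnormal 0 \<Sigma>"
  shows "distr M borel (\<lambda>\<omega>. vec_cols (transp_mult n a (E \<omega>))) =
    mvnormal 0 (kronecker \<Sigma> (transp_mult n a a))"
proof (rule char_fun_unique)
  have Em: "(\<lambda>\<omega>. E \<omega> i) \<in> borel_measurable M" if "i < n" for i
    using indep that by (auto simp: indep_vars_def)
  then have m: "(\<lambda>\<omega>. vec_cols (transp_mult n a (E \<omega>))) \<in> borel_measurable M"
    by (intro measurable_vec_cols measurable_transp_mult)
  then show "prob_space (distr M borel (\<lambda>\<omega>. vec_cols (transp_mult n a (E \<omega>))))"
    by (rule prob_space_distr)
  show "prob_space (mvnormal 0 (kronecker \<Sigma> (transp_mult n a a)))"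
    using \<Sigma> a by (intro prob_space_mvnormal pos_def_kronecker)
  fix t :: "real^('q \<times> 'p)"
  define u where "u i = (\<chi> k j. t $ (k, j)) *v a i" for i
  have "(CLINT x|distr M borel (\<lambda>\<omega>. vec_cols (transp_mult n a (E \<omega>))). iexp (t \<bullet> x)) =
      (CLINT \<omega>|M. (\<Prod>i<n. iexp (u i \<bullet> E \<omega> i)))"
    using m by (simp add: integral_distr inner_vec_cols_transp_mult u_def exp_sum[symmetric] sum_distrib_left)
  also have "\<dots> = (\<Prod>i<n. (CLINT \<omega>|M. iexp (u i \<bullet> E \<omega> i)))"
  proof (rule indep_vars_lebesgue_integral)
    show "indep_vars (\<lambda>_. borel) (\<lambda>i \<omega>. iexp (u i \<bullet> E \<omega> i)) {..<n}"
      by (rule indep_vars_compose2[OF indep, where Y = "\<lambda>i x. iexp (u i \<bullet> x)"]) auto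
    show "integrable M (\<lambda>\<omega>. iexp (u i \<bullet> E \<omega> i))" if "i \<in> {..<n}" for i
      using Em[of i] that by (intro iexp_integrable finite_measure_axioms) auto
  qed simp
  also have "\<dots> = (\<Prod>i<n. complex_of_real (exp (- (u i \<bullet> (\<Sigma> *v u i)) / 2)))"
  proof (rule prod.cong[OF refl])
    fix i assume "i \<in> {..<n}"
    then have "(CLINT \<omega>|M. iexp (u i \<bullet> E \<omega> i)) = (CLINT x|distr M borel (\<lambda>\<omega>. E \<omega> i). iexp (u i \<bullet> x))"
      using Em[of i] by (subst integral_distr) auto
    also have "\<dots> = complex_of_real (exp (- (u i \<bullet> (\<Sigma> *v u i)) / 2))"
      using normal[of i] \<open>i \<in> {..<n}\<close> by (simp only: lessThan_iff char_mvnormal[OF \<Sigma>])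
    finally show "(CLINT \<omega>|M. iexp (u i \<bullet> E \<omega> i)) = complex_of_real (exp (- (u i \<bullet> (\<Sigma> *v u i)) / 2))" .
  qed
  also have "\<dots> = complex_of_real (exp (- (t \<bullet> (kronecker \<Sigma> (transp_mult n a a) *v t)) / 2))"
    by (simp add: inner_kronecker_gram u_def[symmetric] exp_sum[symmetric] sum_negf sum_divide_distrib
        del: of_real_exp flip: of_real_prod)
  also have "\<dots> = (CLINT x|mvnormal 0 (kronecker \<Sigma> (transp_mult n a a)). iexp (t \<bullet> x))"
    using char_mvnormal[OF pos_def_kronecker[OF \<Sigma> a]] by simp
  finally show "(CLINT x|distr M borel (\<lambda>\<omega>. vec_cols (transp_mult n a (E \<omega>))). iexp (t \<bullet> x)) =
      (CLINT x|mvnormal 0 (kronecker \<Sigma> (transp_mult n a a)). iexp (t \<bullet> x))" .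
qed simp_all

text \<open>The statistic is linear in the errors, with coefficient vectors \<open>a i\<close> equal
  to \<open>matrix_inv A *v Z i\<close> over \<open>sqrt n\<close>. Their Gram matrix is
  \<open>matrix_inv A ** A ** matrix_inv A\<close>, hence \<open>matrix_inv A\<close>, so the law is
  exact for finite \<open>n\<close>.\<close>

lemma (in prob_space) distr_normalized_regression_noise:
  fixes Z :: "nat \<Rightarrow> real^'p" and \<Sigma> :: "real^'q^'q" and E :: "'a \<Rightarrow> nat \<Rightarrow> real^'q" and A :: "real^'p^'p"
  assumes \<Sigma>: "pos_def \<Sigma>" and A: "A = (1 / real n) *\<^sub>R transp_mult n Z Z" "pos_def A" and n: "n > 0"
    and indep: "indep_vars (\<lambda>_. borel) (\<lambda>i \<omega>. E \<omega> i) {..<n}"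
    and normal: "\<And>i. i < n \<Longrightarrow> distr M borel (\<lambda>\<omega>. E \<omega> i) = mvnormal 0 \<Sigma>"
  shows "distr M borel (\<lambda>\<omega>. vec_cols (matrix_inv A ** ((1 / sqrt n) *\<^sub>R transp_mult n Z (E \<omega>)))) =
    mvnormal 0 (kronecker \<Sigma> (matrix_inv A))"
proof -
  let ?P = "(1 / sqrt n) *\<^sub>R matrix_inv A"
  define a where "a = (\<lambda>i. ?P *v Z i)"
  note sm = bounded_bilinear.scaleR_left[OF bounded_bilinear_matrix_mult]
    bounded_bilinear.scaleR_right[OF bounded_bilinear_matrix_mult]
  have inv: "invertible A" using A(2) by (rule pos_def_invertible)
  have sym: "transpose (matrix_inv A) = matrix_inv A"
    using pos_def_matrix_inv[OF A(2)] by (simp add: pos_def_def)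
  have aE: "transp_mult n a e = matrix_inv A ** ((1 / sqrt n) *\<^sub>R transp_mult n Z e)" for e :: "nat \<Rightarrow> real^'k"
    by (simp add: a_def transp_mult_linear sm)
  have "transp_mult n a a = matrix_inv A ** ((1 / sqrt n) *\<^sub>R transpose (transp_mult n a Z))"
    by (simp only: transpose_transp_mult aE[of a])
  also have "transpose (transp_mult n a Z) = (1 / sqrt n) *\<^sub>R (transp_mult n Z Z ** matrix_inv A)"
    by (simp add: aE sm transpose_scalar matrix_transpose_mul transpose_transp_mult sym)
  also have "(1 / sqrt n) *\<^sub>R (1 / sqrt n) *\<^sub>R (transp_mult n Z Z ** matrix_inv A) = A ** matrix_inv A"
    using n by (simp add: A(1) sm)
  also have "matrix_inv A ** (A ** matrix_inv A) = matrix_inv A"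
    by (simp add: matrix_inv_mult[OF inv])
  finally have aa: "transp_mult n a a = matrix_inv A" .
  then show ?thesis
    using distr_vec_cols_transp_mult[OF \<Sigma> _ indep normal, of a] pos_def_matrix_inv[OF A(2)]
    by (simp add: aE)
qed

section \<open>Convergence in distribution\<close>

lemma tendsto_det:
  fixes A :: "real^'n^'n"
  assumes "(An \<longlongrightarrow> A) F"
  shows "((\<lambda>n. det (An n)) \<longlongrightarrow> det A) F"
  unfolding det_def by (intro tendsto_intros assms)

lemma norm_integral_le:
  fixes f :: "'a \<Rightarrow> 'b::{banach,second_countable_topology}"
  assumes "integrable M f" "integrable M g" "\<And>x. x \<in> space M \<Longrightarrow> norm (f x) \<le> g x"
  shows "norm (\<integral>x. f x \<partial>M) \<le> (\<integral>x. g x \<partial>M)"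
  by (rule order_trans[OF integral_norm_bound]) (intro integral_mono assms integrable_norm)

lemma mvn_density_nonneg: "det V \<ge> 0 \<Longrightarrow> mvn_density \<mu> V x \<ge> 0"
  by (simp add: mvn_density_def)

text \<open>Convergence is assumed for the inverses: they are what the exponent contains, and in the
  application they are explicit while the covariances are not. The determinants follow as
  reciprocals.\<close>

lemma tendsto_mvn_density:
  fixes V :: "real^'n^'n"
  assumes Vn: "\<forall>\<^sub>F n in sequentially. invertible (Vn n)" and V: "pos_def V"
    and lim: "(\<lambda>n. matrix_inv (Vn n)) \<longlonglongrightarrow> matrix_inv V"
  shows "(\<lambda>n. mvn_density \<mu> (Vn n) x) \<longlonglongrightarrow> mvn_density \<mu> V x"
proof -
  have det_inv: "det A = 1 / det (matrix_inv A)" if "invertible A" for A :: "real^'n^'n"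
  proof -
    have "det A * det (matrix_inv A) = 1"
      using that by (simp add: det_mul[symmetric] matrix_inv_mult)
    then show ?thesis by (metis mult_zero_right nonzero_eq_divide_eq zero_neq_one)
  qed
  have "(\<lambda>n. 1 / det (matrix_inv (Vn n))) \<longlonglongrightarrow> 1 / det (matrix_inv V)"
    using pos_def_det_pos[OF pos_def_matrix_inv[OF V]] by (intro tendsto_intros tendsto_det lim) auto
  then have "(\<lambda>n. det (Vn n)) \<longlonglongrightarrow> det V"
    using det_inv[OF pos_def_invertible[OF V]]
    by (simp, elim Lim_transform_eventually) (use Vn det_inv in \<open>auto elim: eventually_mono\<close>)
  moreover have "(\<lambda>n. matrix_inv (Vn n) *v (x - \<mu>)) \<longlonglongrightarrow> matrix_inv V *v (x - \<mu>)"
    unfolding matrix_vector_mult_def by (intro tendsto_intros lim)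
  moreover have "sqrt ((2 * pi) ^ CARD('n) * det V) \<noteq> 0"
    using pos_def_det_pos[OF V] by simp
  ultimately show ?thesis
    unfolding mvn_density_def by (intro tendsto_intros) auto
qed

text \<open>Pointwise convergence of probability densities implies convergence in the mean, and a
  test function bounded by \<open>B\<close> turns this into convergence of integrals.\<close>

lemma conv_in_distr_mvnormal:
  fixes V :: "real^'n^'n"
  assumes prob: "\<And>n. prob_space (M n)" and Z: "\<And>n. Z n \<in> borel_measurable (M n)"
    and law: "\<forall>\<^sub>F n in sequentially. distr (M n) borel (Z n) = mvnormal 0 (Vn n)"
    and Vn: "\<forall>\<^sub>F n in sequentially. pos_def (Vn n)" and V: "pos_def V"
    and lim: "(\<lambda>n. matrix_inv (Vn n)) \<longlonglongrightarrow> matrix_inv V"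
  shows "conv_in_distr M Z (mvnormal 0 V)"
  unfolding conv_in_distr_def
proof (intro conjI allI impI)
  fix f :: "real^'n \<Rightarrow> real"
  assume f: "continuous_on UNIV f \<and> bounded (range f)"
  then have [measurable]: "f \<in> borel_measurable borel" by (auto intro: borel_measurable_continuous_onI)
  obtain B where B: "\<And>x. \<bar>f x\<bar> \<le> B" using f by (auto simp: bounded_iff)
  \<comment> \<open>The covariances are positive definite only eventually. The value 0 elsewhere
    keeps the integrability and mass conditions of \<open>Scheffe_lemma2\<close> true for every
    \<open>n\<close>.\<close>
  define d where "d n x = (if pos_def (Vn n) then mvn_density 0 (Vn n) x else 0)" for n x
  define d' where "d' = mvn_density 0 V"
  have pos: "mvn_density 0 A x \<ge> 0" if "pos_def A" for A :: "real^'n^'n" and x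
    using pos_def_det_pos[OF that] by (intro mvn_density_nonneg) simp
  have d0: "d n x \<ge> 0" "d' x \<ge> 0" for n x by (auto simp: d_def d'_def pos V)
  have [measurable]: "d n \<in> borel_measurable borel" "d' \<in> borel_measurable borel" for n
    unfolding d_def d'_def by (auto intro: measurable_If)
  have int1: "(\<integral>\<^sup>+x. ennreal (mvn_density 0 A x) \<partial>lborel) = 1" if "pos_def A" for A :: "real^'n^'n"
    using prob_space.emeasure_space_1[OF prob_space_mvnormal[OF that]]
    by (simp add: mvnormal_def emeasure_density)
  have ints: "integrable lborel (d n)" "integrable lborel d'" for n
    using int1 d0 unfolding integrable_iff_bounded
    by (cases "pos_def (Vn n)"; auto simp: d_def d'_def V pos)+
  have "(\<lambda>n. \<integral>\<^sup>+x. norm (d n x - d' x) \<partial>lborel) \<longlonglongrightarrow> 0"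
  proof (rule Scheffe_lemma2)
    have ev: "\<forall>\<^sub>F n in sequentially. invertible (Vn n)"
      using Vn by (rule eventually_mono) (rule pos_def_invertible)
    have "(\<lambda>n. d n x) \<longlonglongrightarrow> d' x" for x
      using tendsto_mvn_density[OF ev V lim] unfolding d'_def
      by (rule Lim_transform_eventually) (use Vn in \<open>auto simp: d_def elim: eventually_mono\<close>)
    then show "AE x in lborel. (\<lambda>n. d n x) \<longlonglongrightarrow> d' x" by simp
    show "(\<integral>\<^sup>+x. norm (d n x) \<partial>lborel) \<le> (\<integral>\<^sup>+x. norm (d' x) \<partial>lborel)" for n
      using d0 int1 V by (cases "pos_def (Vn n)") (simp_all add: d_def d'_def pos)
  qed (use ints in auto)
  moreover have "(\<integral>\<^sup>+x. norm (d n x - d' x) \<partial>lborel) = ennreal (\<integral>x. norm (d n x - d' x) \<partial>lborel)" for n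
    using ints by (intro nn_integral_eq_integral) auto
  ultimately have "(\<lambda>n. \<integral>x. norm (d n x - d' x) \<partial>lborel) \<longlonglongrightarrow> 0"
    by (simp add: tendsto_ennreal_iff[of _ _ 0, simplified])
  then have "(\<lambda>n. B * (\<integral>x. norm (d n x - d' x) \<partial>lborel)) \<longlonglongrightarrow> B * 0"
    by (intro tendsto_intros)
  then have lim0: "(\<lambda>n. B * (\<integral>x. norm (d n x - d' x) \<partial>lborel)) \<longlonglongrightarrow> 0" by simp
  have fint: "integrable lborel (\<lambda>x. g x * f x)" if "integrable lborel g" for g
  proof (rule Bochner_Integration.integrable_bound)
    show "integrable lborel (\<lambda>x. B * g x)" using that by simp
    show "AE x in lborel. norm (g x * f x) \<le> norm (B * g x)"
    proof (rule AE_I2)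
      fix x
      have "\<bar>f x\<bar> \<le> \<bar>B\<bar>" using B[of x] by linarith
      then have "\<bar>f x\<bar> * \<bar>g x\<bar> \<le> \<bar>B\<bar> * \<bar>g x\<bar>" by (rule mult_right_mono) simp
      then show "norm (g x * f x) \<le> norm (B * g x)" by (simp add: abs_mult mult.commute)
    qed
    show "(\<lambda>x. g x * f x) \<in> borel_measurable lborel" using that by measurable
  qed
  have "\<forall>\<^sub>F n in sequentially. norm ((\<integral>\<omega>. f (Z n \<omega>) \<partial>M n) - (\<integral>x. f x \<partial>mvnormal 0 V)) \<le>
      B * (\<integral>x. norm (d n x - d' x) \<partial>lborel)"
    using law Vn
  proof eventually_elim
    case (elim n)
    have "(\<integral>\<omega>. f (Z n \<omega>) \<partial>M n) = (\<integral>x. f x \<partial>mvnormal 0 (Vn n))"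
      using Z[of n] by (simp add: elim(1)[symmetric] integral_distr)
    also have "\<dots> = (\<integral>x. d n x * f x \<partial>lborel)"
      using elim pos by (simp add: mvnormal_def integral_density d_def)
    moreover have "(\<integral>x. f x \<partial>mvnormal 0 V) = (\<integral>x. d' x * f x \<partial>lborel)"
      using V pos by (simp add: mvnormal_def integral_density d'_def)
    ultimately have "(\<integral>\<omega>. f (Z n \<omega>) \<partial>M n) - (\<integral>x. f x \<partial>mvnormal 0 V) = (\<integral>x. (d n x - d' x) * f x \<partial>lborel)"
      using fint[OF ints(1), of n] fint[OF ints(2)]
      by (simp add: left_diff_distrib Bochner_Integration.integral_diff)
    also have "norm \<dots> \<le> (\<integral>x. B * norm (d n x - d' x) \<partial>lborel)"
      using ints B by (intro norm_integral_le fint Bochner_Integration.integrable_diff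
          integrable_mult_right integrable_norm)
        (auto simp: abs_mult mult.commute intro!: mult_right_mono)
    finally show ?case by simp
  qed
  from Lim_null_comparison[OF this lim0] show "(\<lambda>n. \<integral>\<omega>. f (Z n \<omega>) \<partial>M n) \<longlonglongrightarrow> (\<integral>x. f x \<partial>mvnormal 0 V)"
    by (simp add: LIM_zero_iff)
qed (rule Z)

lemma conv_in_distr_tight:
  fixes V :: "nat \<Rightarrow> 'w \<Rightarrow> 'a::euclidean_space"
  assumes prob: "\<And>n. prob_space (M n)" and V: "conv_in_distr M V N"
    and N: "prob_space N" "sets N = sets borel" and "\<epsilon> > 0"
  obtains K where "\<forall>\<^sub>F n in sequentially. measure (M n) {\<omega> \<in> space (M n). norm (V n \<omega>) > K} < \<epsilon>"
proof -
  interpret N: prob_space N by fact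
  note N(2)[measurable_cong]
  \<comment> \<open>A continuous ramp: 0 on the ball of radius \<open>K\<close>, 1 outside that of
    radius \<open>K + 1\<close>, so it dominates the indicator of the outer tail and is an
    admissible test function.\<close>
  define f where "f K x = min 1 (max 0 (norm x - real K))" for K and x :: 'a
  have f01: "0 \<le> f K x" "f K x \<le> 1" for K x by (auto simp: f_def)
  have fc: "continuous_on UNIV (f K)" for K unfolding f_def by (intro continuous_intros)
  then have [measurable]: "f K \<in> borel_measurable borel" for K by (intro borel_measurable_continuous_onI)
  have "(\<lambda>K. \<integral>x. f K x \<partial>N) \<longlonglongrightarrow> (\<integral>x. 0 \<partial>N)"
  proof (rule integral_dominated_convergence[where w="\<lambda>_. 1"])
    show "AE x in N. (\<lambda>K. f K x) \<longlonglongrightarrow> 0"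
    proof (rule AE_I2)
      fix x :: 'a
      obtain K0 where K0: "norm x \<le> real K0" using real_arch_simple by blast
      have "\<forall>\<^sub>F K in sequentially. f K x = 0"
        using eventually_ge_at_top[of K0]
        by (rule eventually_mono) (use K0 in \<open>auto simp: f_def\<close>)
      then show "(\<lambda>K. f K x) \<longlonglongrightarrow> 0" by (rule tendsto_eventually)
    qed
  qed (use f01 in auto)
  then have "\<forall>\<^sub>F K in sequentially. (\<integral>x. f K x \<partial>N) < \<epsilon>"
    using \<open>\<epsilon> > 0\<close> by (intro order_tendstoD(2)[where y=0]) auto
  then obtain K where K: "(\<integral>x. f K x \<partial>N) < \<epsilon>" by (auto simp: eventually_sequentially)
  have "bounded (range (f K))" using f01 by (auto simp: bounded_iff intro!: exI[of _ 1])
  then have "(\<lambda>n. \<integral>\<omega>. f K (V n \<omega>) \<partial>M n) \<longlonglongrightarrow> (\<integral>x. f K x \<partial>N)"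
    using V fc by (auto simp: conv_in_distr_def)
  from order_tendstoD(2)[OF this K] 
  have "\<forall>\<^sub>F n in sequentially. measure (M n) {\<omega> \<in> space (M n). norm (V n \<omega>) > real K + 1} < \<epsilon>"
  proof eventually_elim
    case (elim n)
    interpret Mn: prob_space "M n" by (rule prob)
    have [measurable]: "V n \<in> borel_measurable (M n)" using V by (simp add: conv_in_distr_def)
    have "measure (M n) {\<omega> \<in> space (M n). norm (V n \<omega>) > real K + 1} =
        (\<integral>\<omega>. indicator {\<omega> \<in> space (M n). norm (V n \<omega>) > real K + 1} \<omega> \<partial>M n)"
      by (simp add: Int_def conj_commute cong: conj_cong)
    also have "\<dots> \<le> (\<integral>\<omega>. f K (V n \<omega>) \<partial>M n)"
    proof (rule integral_mono)
      show "integrable (M n) (\<lambda>\<omega>. f K (V n \<omega>))"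
        using f01 by (intro Mn.integrable_const_bound[of _ 1]) auto
      show "integrable (M n) (indicat_real {\<omega> \<in> space (M n). norm (V n \<omega>) > real K + 1})"
        by (intro integrable_real_indicator) (auto simp: less_top[symmetric])
    qed (auto simp: f_def indicator_def)
    finally show ?case using elim by simp
  qed
  then show ?thesis by (rule that)
qed

text \<open>A form of Slutsky's theorem. A continuous test function is uniformly continuous only on
  balls, so tightness of \<open>V\<close> is used to stay inside one.\<close>

lemma conv_in_distr_perturb:
  fixes V Z :: "nat \<Rightarrow> 'w \<Rightarrow> 'a::euclidean_space"
  assumes prob: "\<And>n. prob_space (M n)" and V: "conv_in_distr M V N"
    and N: "prob_space N" "sets N = sets borel" and Z: "\<And>n. Z n \<in> borel_measurable (M n)"
    and close: "\<And>\<eta>. \<eta> > 0 \<Longrightarrow> (\<lambda>n. measure (M n) {\<omega> \<in> space (M n). dist (Z n \<omega>) (V n \<omega>) > \<eta>}) \<longlonglongrightarrow> 0"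
  shows "conv_in_distr M Z N"
  unfolding conv_in_distr_def
proof (intro conjI allI impI)
  fix f :: "'a \<Rightarrow> real"
  assume f: "continuous_on UNIV f \<and> bounded (range f)"
  then have fm [measurable]: "f \<in> borel_measurable borel" by (auto intro: borel_measurable_continuous_onI)
  obtain B where B: "\<And>x. \<bar>f x\<bar> \<le> B" using f by (auto simp: bounded_iff)
  then have "B \<ge> 0" using abs_ge_zero order_trans by blast
  have Vm: "V n \<in> borel_measurable (M n)" for n using V by (simp add: conv_in_distr_def)
  have fint: "integrable (M n) (\<lambda>\<omega>. f (g \<omega>))" if "g \<in> borel_measurable (M n)" for n g
  proof -
    interpret Mn: prob_space "M n" by (rule prob)
    show ?thesis using B that by (intro Mn.integrable_const_bound[of _ B]) auto
  qed
  have "(\<lambda>n. (\<integral>\<omega>. f (Z n \<omega>) \<partial>M n) - (\<integral>\<omega>. f (V n \<omega>) \<partial>M n)) \<longlonglongrightarrow> 0"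
  proof (rule LIMSEQ_I)
    fix r :: real assume "r > 0"
    \<comment> \<open>The three contributions below add up to \<open>e * (1 + 4 * B)\<close>, which
      has to stay below \<open>r\<close>.\<close>
    define e where "e = r / (2 + 4 * B)"
    have "e > 0" "e * (1 + 4 * B) < r"
      using \<open>r > 0\<close> \<open>B \<ge> 0\<close> by (auto simp: e_def field_simps)
    obtain K where K: "\<forall>\<^sub>F n in sequentially. measure (M n) {\<omega> \<in> space (M n). norm (V n \<omega>) > K} < e"
      using conv_in_distr_tight[OF prob V N \<open>e > 0\<close>] .
    have "uniformly_continuous_on (cball 0 (K + 1)) f"
      using f by (intro compact_uniformly_continuous) (auto intro: continuous_on_subset)
    then obtain \<delta> where \<delta>: "\<delta> > 0"
      "\<And>x y. x \<in> cball 0 (K + 1) \<Longrightarrow> y \<in> cball 0 (K + 1) \<Longrightarrow> dist x y < \<delta> \<Longrightarrow> dist (f x) (f y) < e"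
      using \<open>e > 0\<close> unfolding uniformly_continuous_on_def by metis
    \<comment> \<open>The bound 1 keeps \<open>Z n \<omega>\<close> in the ball of radius
      \<open>K + 1\<close>; the half makes the distance strictly less than \<delta>.\<close>
    define \<eta> where "\<eta> = min 1 (\<delta> / 2)"
    have "\<eta> > 0" using \<delta> by (simp add: \<eta>_def)
    have "\<forall>\<^sub>F n in sequentially. measure (M n) {\<omega> \<in> space (M n). dist (Z n \<omega>) (V n \<omega>) > \<eta>} < e"
      using close[OF \<open>\<eta> > 0\<close>] \<open>e > 0\<close> by (rule order_tendstoD)
    with K have "\<forall>\<^sub>F n in sequentially.
      norm ((\<integral>\<omega>. f (Z n \<omega>) \<partial>M n) - (\<integral>\<omega>. f (V n \<omega>) \<partial>M n) - 0) < r"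
    proof eventually_elim
      case (elim n)
      interpret Mn: prob_space "M n" by (rule prob)
      note [measurable] = Vm Z
      let ?A = "{\<omega> \<in> space (M n). norm (V n \<omega>) > K}" and ?D = "{\<omega> \<in> space (M n). dist (Z n \<omega>) (V n \<omega>) > \<eta>}"
      have [measurable]: "?A \<in> sets (M n)" "?D \<in> sets (M n)" by measurable
      let ?g = "\<lambda>\<omega>. e + 2 * B * indicator ?A \<omega> + 2 * B * indicator ?D \<omega>"
      have "norm (\<integral>\<omega>. f (Z n \<omega>) - f (V n \<omega>) \<partial>M n) \<le> (\<integral>\<omega>. ?g \<omega> \<partial>M n)"
      proof (rule norm_integral_le)
        show "integrable (M n) (\<lambda>\<omega>. f (Z n \<omega>) - f (V n \<omega>))"
          using fint[OF Z] fint[OF Vm] by (rule Bochner_Integration.integrable_diff)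
        show "integrable (M n) ?g"
          by (intro Bochner_Integration.integrable_add integrable_mult_right integrable_real_indicator)
            (auto simp: less_top[symmetric])
        fix \<omega> assume \<omega>: "\<omega> \<in> space (M n)"
        show "norm (f (Z n \<omega>) - f (V n \<omega>)) \<le> ?g \<omega>"
        proof (cases "\<omega> \<in> ?A \<or> \<omega> \<in> ?D")
          case True
          have "norm (f (Z n \<omega>) - f (V n \<omega>)) \<le> 2 * B"
            using B[of "Z n \<omega>"] B[of "V n \<omega>"] by simp
          also have "\<dots> \<le> ?g \<omega>" using True \<open>e > 0\<close> \<open>B \<ge> 0\<close> by (auto simp: indicator_def)
          finally show ?thesis .
        next
          case False
          then have h: "norm (V n \<omega>) \<le> K" "dist (Z n \<omega>) (V n \<omega>) \<le> \<eta>" using \<omega> by auto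
          have "norm (Z n \<omega>) \<le> norm (V n \<omega>) + dist (Z n \<omega>) (V n \<omega>)"
            by (metis dist_norm norm_triangle_sub)
          then have "norm (Z n \<omega>) \<le> K + 1" using h by (simp add: \<eta>_def)
          moreover have "dist (Z n \<omega>) (V n \<omega>) < \<delta>" using h \<delta>(1) by (simp add: \<eta>_def)
          ultimately have "dist (f (Z n \<omega>)) (f (V n \<omega>)) < e" using h by (intro \<delta>(2)) auto
          then show ?thesis using \<open>B \<ge> 0\<close> by (simp add: dist_norm add_increasing2)
        qed
      qed
      also have "(\<integral>\<omega>. ?g \<omega> \<partial>M n) = e + 2 * B * measure (M n) ?A + 2 * B * measure (M n) ?D"
        by (subst Bochner_Integration.integral_add;
            (subst Bochner_Integration.integral_add)?;
            auto simp: less_top[symmetric] Mn.prob_space Int_absorb2 intro!: integrable_real_indicator)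
      also have "\<dots> \<le> e + 2 * B * e + 2 * B * e"
        using elim \<open>B \<ge> 0\<close> by (intro add_mono mult_left_mono) auto
      also have "\<dots> < r" using \<open>e * (1 + 4 * B) < r\<close> by (simp add: algebra_simps)
      finally show ?case using fint[OF Z] fint[OF Vm] by simp
    qed
    then show "\<exists>no. \<forall>n\<ge>no. norm ((\<integral>\<omega>. f (Z n \<omega>) \<partial>M n) - (\<integral>\<omega>. f (V n \<omega>) \<partial>M n) - 0) < r"
      by (simp add: eventually_sequentially)
  qed
  moreover have "(\<lambda>n. \<integral>\<omega>. f (V n \<omega>) \<partial>M n) \<longlonglongrightarrow> (\<integral>x. f x \<partial>N)"
    using V f by (simp add: conv_in_distr_def)
  ultimately show "(\<lambda>n. \<integral>\<omega>. f (Z n \<omega>) \<partial>M n) \<longlonglongrightarrow> (\<integral>x. f x \<partial>N)"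
    using tendsto_add by fastforce
qed (rule Z)

text \<open>Lets a pathwise bound that holds only where a tight variable \<open>T\<close> is bounded
  give convergence in probability: \<open>K\<close> is chosen after \<open>r\<close>, so that the
  excluded event has probability below \<open>r\<close>.\<close>

lemma dist_tendsto_0_in_prob:
  fixes V Z :: "nat \<Rightarrow> 'w \<Rightarrow> 'a::euclidean_space" and T :: "nat \<Rightarrow> 'w \<Rightarrow> 'b::euclidean_space"
  assumes prob: "\<And>n. prob_space (M n)" and T: "conv_in_distr M T N"
    and N: "prob_space N" "sets N = sets borel"
    and ae: "\<And>K. \<forall>\<^sub>F n in sequentially. AE \<omega> in M n. norm (T n \<omega>) \<le> K \<longrightarrow> dist (Z n \<omega>) (V n \<omega>) \<le> \<eta>"
  shows "(\<lambda>n. measure (M n) {\<omega> \<in> space (M n). dist (Z n \<omega>) (V n \<omega>) > \<eta>}) \<longlonglongrightarrow> 0"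
proof (rule LIMSEQ_I)
  fix r :: real assume "r > 0"
  obtain K where K: "\<forall>\<^sub>F n in sequentially. measure (M n) {\<omega> \<in> space (M n). norm (T n \<omega>) > K} < r"
    using conv_in_distr_tight[OF prob T N \<open>r > 0\<close>] .
  from K ae[of K] have "\<forall>\<^sub>F n in sequentially.
    norm (measure (M n) {\<omega> \<in> space (M n). dist (Z n \<omega>) (V n \<omega>) > \<eta>} - 0) < r"
  proof eventually_elim
    case (elim n)
    interpret Mn: prob_space "M n" by (rule prob)
    have [measurable]: "T n \<in> borel_measurable (M n)" using T by (simp add: conv_in_distr_def)
    have "measure (M n) {\<omega> \<in> space (M n). dist (Z n \<omega>) (V n \<omega>) > \<eta>} \<le>
        measure (M n) {\<omega> \<in> space (M n). norm (T n \<omega>) > K}"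
      by (rule Mn.finite_measure_mono_AE) (use elim(2) in auto)
    with elim show ?case by simp
  qed
  then show "\<exists>no. \<forall>n\<ge>no. norm (measure (M n) {\<omega> \<in> space (M n). dist (Z n \<omega>) (V n \<omega>) > \<eta>} - 0) < r"
    by (simp add: eventually_sequentially)
qed

section \<open>The one-step estimate\<close>

lemma sum_UNIV_Plus:
  "(\<Sum>x\<in>UNIV. f (x :: 'a::finite + 'b::finite)) = (\<Sum>i\<in>UNIV. f (Inl i)) + (\<Sum>k\<in>UNIV. f (Inr k))"
  by (simp add: UNIV_sum[symmetric] UNIV_Plus_UNIV[symmetric] sum.Plus del: UNIV_Plus_UNIV)

lemma norm_vec_cols: "norm (vec_cols A) = norm A"
proof -
  have "norm (vec_cols A) ^ 2 = norm A ^ 2"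
    unfolding power2_norm_eq_inner
    by (simp add: inner_vec_def vec_cols_def sum_UNIV_Times) (rule sum.swap)
  then show ?thesis by simp
qed

lemma inner_matrix_mult_commute:
  fixes A :: "real^'p^'p" and G H :: "real^'q^'p"
  assumes "transpose A = A"
  shows "G \<bullet> (A ** H) = H \<bullet> (A ** G)"
proof -
  have "x \<bullet> (A *v y) = y \<bullet> (A *v x)" for x y
    by (metis assms inner_commute inner_transpose_matrix_vector)
  then show ?thesis unfolding inner_matrix_mult_columns by simp
qed

lemma norm_bottom_rows_le: "norm (bottom_rows U) \<le> (\<Sum>k\<in>UNIV. norm (U $ Inr k))"
  unfolding norm_vec_def[of "bottom_rows U"]
  by (rule order_trans[OF L2_set_le_sum]) (auto simp: bottom_rows_def)

lemma norm_stack_rows: "norm (stack_rows A B)^2 = norm A ^ 2 + norm B ^ 2"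
  by (simp add: power2_norm_eq_inner inner_vec_def sum_UNIV_Plus stack_rows_def)

lemma stack_rows_top_bottom: "stack_rows (top_rows U) (bottom_rows U) = U"
  by (simp add: stack_rows_def top_rows_def bottom_rows_def vec_eq_iff split: sum.split)

lemma norm_top_rows_le: "norm (top_rows U) \<le> norm U"
proof -
  have "norm (top_rows U)^2 \<le> norm U ^ 2"
    by (subst (2) stack_rows_top_bottom[symmetric], subst norm_stack_rows) simp
  then show ?thesis by (rule power2_le_imp_le) simp
qed

text \<open>A convex penalty whose slope on the lower rows exceeds the gradient of the quadratic part
  annihilates these rows; then the upper rows are within \<open>O(e)\<close> of the unpenalised minimiser \<open>V\<close>.\<close>

lemma penalized_minimizer:
  fixes A :: "real^('a::finite+'b::finite)^('a+'b)" and W U :: "real^'q^('a+'b)" and V :: "real^'q^'a"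
    and g :: "'a \<Rightarrow> real^'q \<Rightarrow> real" and L :: "'b \<Rightarrow> real"
  defines "Q \<equiv> \<lambda>H::real^'q^('a+'b). H \<bullet> (A ** H) - 2 * (H \<bullet> W) + (\<Sum>i\<in>UNIV. g i (H $ Inl i))
    + (\<Sum>k\<in>UNIV. L k * norm (H $ Inr k))"
  assumes sym: "transpose A = A" and c: "c > 0"
    and coercive: "\<And>H::real^'q^('a+'b). H \<bullet> (A ** H) \<ge> c * (norm H)\<^sup>2"
    and bounded: "\<And>H::real^'q^('a+'b). norm (A ** H) \<le> K0 * norm H"
    and K0: "K0 \<ge> 0" and W: "norm W \<le> K"
    and g: "\<And>i u v. \<bar>g i u - g i v\<bar> \<le> e * norm (u - v)" and e: "e \<ge> 0"
    and R: "2 * K + e * CARD('a) \<le> R * c"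
    and L: "\<And>k. L k > 2 * K0 * R + 2 * K"
    and min: "\<And>H. Q U \<le> Q H"
    and V: "upper_left A ** V = top_rows W"
  shows "bottom_rows U = 0" "norm (top_rows U - V) \<le> e * CARD('a) / c"
proof -
  have Kpos: "K \<ge> 0" using W norm_ge_zero order_trans by blast
  have Rpos: "R \<ge> 0"
  proof (rule ccontr)
    assume "\<not> R \<ge> 0"
    then have "R * c < 0" using c by (simp add: mult_neg_pos)
    moreover have "2 * K + e * CARD('a) \<ge> 0" using Kpos e by simp
    ultimately show False using R by linarith
  qed
  have Lpos: "L k > 0" for k
  proof -
    have "2 * K0 * R + 2 * K \<ge> 0" using K0 Rpos Kpos by simp
    then show ?thesis using L[of k] by linarith
  qed
  have inner_W: "\<bar>H \<bullet> W\<bar> \<le> K * norm H" for H :: "real^'q^('a+'b)"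
    by (metis Cauchy_Schwarz_ineq2 W mult.commute mult_right_mono norm_ge_zero order_trans)
  have sum_top: "(\<Sum>i\<in>UNIV. \<bar>g i (G $ Inl i) - g i (H $ Inl i)\<bar>) \<le> e * CARD('a) * norm (top_rows G - top_rows H)"
    for G H :: "real^'q^('a+'b)"
  proof -
    have "(\<Sum>i\<in>UNIV. \<bar>g i (G $ Inl i) - g i (H $ Inl i)\<bar>) \<le> (\<Sum>i\<in>(UNIV::'a set). e * norm (top_rows G - top_rows H))"
    proof (rule sum_mono)
      fix i
      have "norm (G $ Inl i - H $ Inl i) \<le> norm (top_rows G - top_rows H)"
        using Finite_Cartesian_Product.norm_nth_le[of "top_rows G - top_rows H" i] by (simp add: top_rows_def)
      then show "\<bar>g i (G $ Inl i) - g i (H $ Inl i)\<bar> \<le> e * norm (top_rows G - top_rows H)"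
        using g e by (meson mult_left_mono order_trans)
    qed
    then show ?thesis by (simp add: mult.assoc mult.left_commute)
  qed
  \<comment> \<open>First competitor, the zero matrix: it gives
    \<open>c * (norm U)\<^sup>2 \<le> (2 * K + e * CARD('a)) * norm U\<close>, which explains the
    condition on \<open>R\<close>.\<close>
  have U_bound: "norm U \<le> R"
  proof -
    have "Q U \<le> Q 0" by (rule min)
    then have "U \<bullet> (A ** U) + (\<Sum>k\<in>UNIV. L k * norm (U $ Inr k)) \<le>
        2 * (U \<bullet> W) + (\<Sum>i\<in>UNIV. g i ((0::real^'q^('a+'b)) $ Inl i) - g i (U $ Inl i))"
      by (simp add: Q_def sum_subtractf)
    also have "\<dots> \<le> 2 * (K * norm U) + (\<Sum>i\<in>UNIV. \<bar>g i ((0::real^'q^('a+'b)) $ Inl i) - g i (U $ Inl i)\<bar>)"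
      using inner_W[of U] by (intro add_mono sum_mono) auto
    also have "\<dots> \<le> 2 * (K * norm U) + e * CARD('a) * norm U"
    proof -
      have "norm (top_rows (0::real^'q^('a+'b)) - top_rows U) \<le> norm U"
      proof -
        have "top_rows (0::real^'q^('a+'b)) - top_rows U = - top_rows U"
          by (simp add: top_rows_def vec_eq_iff)
        then show ?thesis using norm_top_rows_le[of U] by simp
      qed
      then have "e * CARD('a) * norm (top_rows (0::real^'q^('a+'b)) - top_rows U) \<le> e * CARD('a) * norm U"
        using e by (intro mult_left_mono) auto
      then show ?thesis using sum_top[of 0 U] by linarith
    qed
    also have "\<dots> = (2 * K + e * CARD('a)) * norm U" by (simp add: algebra_simps)
    also have "\<dots> \<le> (R * c) * norm U" using R by (intro mult_right_mono) auto
    finally have "U \<bullet> (A ** U) + (\<Sum>k\<in>UNIV. L k * norm (U $ Inr k)) \<le> (R * c) * norm U" .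
    moreover have "(\<Sum>k\<in>UNIV. L k * norm (U $ Inr k)) \<ge> 0"
      using Lpos by (intro sum_nonneg mult_nonneg_nonneg) (auto intro: less_imp_le)
    ultimately have "c * (norm U)\<^sup>2 \<le> (R * c) * norm U" using coercive[of U] by linarith
    then have "c * norm U * norm U \<le> c * R * norm U" by (simp add: power2_eq_square mult_ac)
    then show ?thesis using c Rpos by (cases "norm U = 0") (auto simp: mult_le_cancel_right)
  qed
  have expand: "(G + D) \<bullet> (A ** (G + D)) = G \<bullet> (A ** G) + 2 * (D \<bullet> (A ** G)) + D \<bullet> (A ** D)"
    for G D :: "real^'q^('a+'b)"
    using inner_matrix_mult_commute[OF sym, of G D]
    by (simp add: bounded_bilinear.add_right[OF bounded_bilinear_matrix_mult] inner_add_left inner_add_right)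
  show bot: "bottom_rows U = 0"
  proof (rule ccontr)
    assume nz: "bottom_rows U \<noteq> 0"
    \<comment> \<open>Second competitor: \<open>U\<close> with its lower rows \<open>D\<close>
      deleted. On the ball of radius \<open>R\<close> the gradient of the quadratic part is at most
      \<open>2 * K0 * R + 2 * K\<close>, so deleting \<open>D\<close> would save more penalty than
      it can cost.\<close>
    define G where "G = stack_rows (top_rows U) (0 :: real^'q^'b)"
    define D where "D = stack_rows (0 :: real^'q^'a) (bottom_rows U)"
    have UGD: "U = G + D"
      by (simp add: G_def D_def stack_rows_def top_rows_def bottom_rows_def vec_eq_iff split: sum.split)
    have GD: "norm G \<le> norm U" "norm D = norm (bottom_rows U)"
      using norm_stack_rows[of "top_rows U" "0 :: real^'q^'b"]
        norm_stack_rows[of "0 :: real^'q^'a" "bottom_rows U"] norm_top_rows_le[of U]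
      by (simp_all add: G_def D_def)
    have q: "U \<bullet> (A ** U) = G \<bullet> (A ** G) + 2 * (D \<bullet> (A ** G)) + D \<bullet> (A ** D)"
      using expand[of G D] by (simp only: UGD[symmetric])
    have w: "U \<bullet> W = G \<bullet> W + D \<bullet> W"
      using inner_add_left[of G D W] by (simp only: UGD[symmetric])
    have GI: "G $ Inl i = U $ Inl i" and GR: "G $ Inr k = 0" for i k
      by (simp_all add: G_def stack_rows_def top_rows_def)
    have "Q U \<le> Q G" by (rule min)
    then have "2 * (D \<bullet> (A ** G)) + D \<bullet> (A ** D) - 2 * (D \<bullet> W) + (\<Sum>k\<in>UNIV. L k * norm (U $ Inr k)) \<le> 0"
      unfolding Q_def q w by (simp add: GI GR)
    moreover have "D \<bullet> (A ** D) \<ge> 0"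
      using coercive[of D] c by (meson mult_nonneg_nonneg less_imp_le order_trans zero_le_power2)
    moreover have "\<bar>D \<bullet> (A ** G)\<bar> \<le> norm D * (K0 * R)"
    proof -
      have "\<bar>D \<bullet> (A ** G)\<bar> \<le> norm D * norm (A ** G)" by (rule Cauchy_Schwarz_ineq2)
      also have "\<dots> \<le> norm D * (K0 * R)"
        using bounded[of G] GD(1) U_bound K0
        by (intro mult_left_mono) (auto intro: order_trans mult_left_mono)
      finally show ?thesis .
    qed
    moreover have "(\<Sum>k\<in>UNIV. L k * norm (U $ Inr k)) > (2 * K0 * R + 2 * K) * norm D"
    proof -
      obtain k where k: "U $ Inr k \<noteq> 0"
        using nz by (auto simp: bottom_rows_def vec_eq_iff)
      have "(2 * K0 * R + 2 * K) * norm D \<le> (2 * K0 * R + 2 * K) * (\<Sum>k\<in>UNIV. norm (U $ Inr k))"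
        using norm_bottom_rows_le[of U] K0 Rpos Kpos by (simp add: GD mult_left_mono)
      also have "\<dots> = (\<Sum>k\<in>UNIV. (2 * K0 * R + 2 * K) * norm (U $ Inr k))"
        by (rule sum_distrib_left)
      also have "\<dots> < (\<Sum>k\<in>UNIV. L k * norm (U $ Inr k))"
      proof (rule sum_strict_mono_ex1)
        show "\<forall>k\<in>UNIV. (2 * K0 * R + 2 * K) * norm (U $ Inr k) \<le> L k * norm (U $ Inr k)"
          by (auto intro!: mult_right_mono less_imp_le[OF L])
        show "\<exists>k\<in>UNIV. (2 * K0 * R + 2 * K) * norm (U $ Inr k) < L k * norm (U $ Inr k)"
          using k L[of k] by (intro bexI[of _ k] mult_strict_right_mono) auto
      qed simp
      finally show ?thesis .
    qed
    ultimately show False using inner_W[of D] by (simp add: algebra_simps)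
  qed
  \<comment> \<open>Third competitor: the unpenalised minimiser \<open>V\<close> padded with zero
    rows. Stationarity of \<open>V\<close> makes the term linear in \<open>D\<close> cancel, leaving
    \<open>D \<bullet> (A ** D)\<close> against the Lipschitz bound of the
    \<open>g i\<close>.\<close>
  define G where "G = stack_rows V (0 :: real^'q^'b)"
  define D where "D = stack_rows (top_rows U - V) (0 :: real^'q^'b)"
  have Uk: "U $ Inr k = 0" for k
    using bot by (auto simp: bottom_rows_def vec_eq_iff)
  have UGD: "U = G + D"
    using Uk by (simp add: G_def D_def stack_rows_def top_rows_def vec_eq_iff split: sum.split)
  have nD: "norm D = norm (top_rows U - V)"
    using norm_stack_rows[of "top_rows U - V" "0 :: real^'q^'b"] by (simp add: D_def)
  have DW: "D \<bullet> (A ** G) = D \<bullet> W"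
  proof -
    have "(A ** G) $ Inl i = W $ Inl i" for i
    proof -
      have "(A ** G) $ Inl i = (upper_left A ** V) $ i"
        by (simp add: matrix_matrix_mult_def G_def stack_rows_def upper_left_def sum_UNIV_Plus vec_eq_iff)
      then show ?thesis by (simp add: V top_rows_def)
    qed
    moreover have "D $ Inr k = 0" for k by (simp add: D_def stack_rows_def)
    ultimately show ?thesis unfolding inner_vec_def[of D] by (simp add: sum_UNIV_Plus)
  qed
  have q: "U \<bullet> (A ** U) = G \<bullet> (A ** G) + 2 * (D \<bullet> (A ** G)) + D \<bullet> (A ** D)"
    using expand[of G D] by (simp only: UGD[symmetric])
  have w: "U \<bullet> W = G \<bullet> W + D \<bullet> W"
    using inner_add_left[of G D W] by (simp only: UGD[symmetric])
  have GR: "G $ Inr k = 0" for k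
    by (simp add: G_def stack_rows_def)
  have "Q U \<le> Q G" by (rule min)
  then have "D \<bullet> (A ** D) \<le> (\<Sum>i\<in>UNIV. g i (G $ Inl i) - g i (U $ Inl i))"
    unfolding Q_def q w DW by (simp add: Uk GR sum_subtractf)
  also have "\<dots> \<le> (\<Sum>i\<in>UNIV. \<bar>g i (G $ Inl i) - g i (U $ Inl i)\<bar>)"
    by (intro sum_mono) auto
  also have "\<dots> \<le> e * CARD('a) * norm (top_rows G - top_rows U)" by (rule sum_top)
  also have "top_rows G = V" by (simp add: G_def stack_rows_def top_rows_def vec_eq_iff)
  finally have "c * (norm D)\<^sup>2 \<le> e * CARD('a) * norm D"
    using coercive[of D] by (simp add: nD norm_minus_commute)
  then have "norm D * (c * norm D) \<le> norm D * (e * CARD('a))" by (simp add: power2_eq_square mult_ac)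
  then have "norm D = 0 \<or> c * norm D \<le> e * CARD('a)"
    using norm_ge_zero[of D] mult_le_cancel_left_pos[of "norm D"] by (metis less_le)
  then show "norm (top_rows U - V) \<le> e * CARD('a) / c"
    using c e by (auto simp: nD field_simps)
qed

text \<open>A concave function lies below its tangents. A negative slope would carry it below 0 on
  the half-line, and comparing two tangents gives monotonicity of the derivative.\<close>

lemma concave_nonneg_deriv:
  fixes p :: "real \<Rightarrow> real"
  assumes conc: "concave_on {0..} p" and nonneg: "\<And>r. r \<ge> 0 \<Longrightarrow> p r \<ge> 0"
    and diff: "\<And>r. r > 0 \<Longrightarrow> p differentiable (at r)"
  shows "r > 0 \<Longrightarrow> deriv p r \<ge> 0" "0 < r \<Longrightarrow> r \<le> t \<Longrightarrow> deriv p t \<le> deriv p r"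
proof -
  have tangent: "p y \<le> p x + deriv p x * (y - x)" if "x > 0" "y > 0" for x y
  proof -
    have "convex_on {0<..} (\<lambda>x. - p x)"
      using conc unfolding concave_on_def by (rule convex_on_subset) auto
    moreover have "((\<lambda>x. - p x) has_real_derivative (- deriv p x)) (at x within {0<..})"
      using diff[OF that(1), folded DERIV_deriv_iff_real_differentiable]
      by (rule DERIV_minus[OF DERIV_subset[OF _ subset_UNIV]])
    ultimately have "- p y - (- p x) \<ge> - deriv p x * (y - x)"
      using that by (intro convex_on_imp_above_tangent) (auto simp: connected_Ioi interior_open)
    then show ?thesis by simp
  qed
  show nn: "deriv p r \<ge> 0" if "r > 0" for r
  proof (rule ccontr)
    assume "\<not> deriv p r \<ge> 0"
    \<comment> \<open>The tangent at \<open>r\<close> takes the value -1 at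
      \<open>r + h\<close>.\<close>
    define h where "h = (p r + 1) / (- deriv p r)"
    have "h > 0" using nonneg[of r] that \<open>\<not> deriv p r \<ge> 0\<close> by (simp add: h_def divide_pos_neg)
    then have "p (r + h) \<le> p r + deriv p r * h"
      using tangent[of r "r + h"] that by simp
    also have "deriv p r * h = - (p r + 1)" using \<open>\<not> deriv p r \<ge> 0\<close> by (simp add: h_def)
    finally show False using nonneg[of "r + h"] \<open>h > 0\<close> that by simp
  qed
  show "deriv p t \<le> deriv p r" if "0 < r" "r \<le> t"
  proof (cases "r = t")
    case False
    \<comment> \<open>Sum of the tangent inequalities at \<open>r\<close> and at
      \<open>t\<close>.\<close>
    have "0 \<le> (deriv p r - deriv p t) * (t - r)"
      using tangent[of r t] tangent[of t r] that by (simp add: algebra_simps)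
    then show ?thesis using False that by (simp add: zero_le_mult_iff)
  qed simp
qed

lemma transp_mult_response:
  "transp_mult n X (response X B E) = transp_mult n X X ** B + transp_mult n X E"
proof -
  have "(\<Sum>i<n. X i $ j * (\<Sum>l\<in>UNIV. X i $ l * B $ l $ k)) = (\<Sum>l\<in>UNIV. (\<Sum>i<n. X i $ j * X i $ l) * B $ l $ k)" for j k
    unfolding sum_distrib_left sum_distrib_right by (subst sum.swap) (simp add: mult_ac)
  then show ?thesis
    by (simp add: transp_mult_def response_def matrix_matrix_mult_def vector_matrix_mult_def vec_eq_iff
        distrib_left sum.distrib)
qed

text \<open>Moves the origin to the matrix that generated the response: the residuals become
  \<open>E i - X i v* H\<close>, and design and errors act on \<open>H\<close> only through
  \<open>transp_mult n X X\<close> and \<open>transp_mult n X E\<close>.\<close>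

lemma one_step_objective_expand:
  fixes X :: "'p::finite row_family" and B H Bs :: "real^'q^'p" and E :: "'q row_family"
  shows "one_step_objective n X (response X B E) lam p Bs (B + H) =
    (\<Sum>i<n. E i \<bullet> E i) + H \<bullet> (transp_mult n X X ** H) - 2 * (H \<bullet> transp_mult n X E)
    + lam * (\<Sum>j\<in>UNIV. deriv p (norm (Bs $ j)) * norm (B $ j + H $ j))"
proof -
  have r: "response X B E i - X i v* (B + H) = E i - X i v* H" for i
    by (simp add: response_def vector_matrix_mult_def vec_eq_iff distrib_right sum.distrib algebra_simps)
  have tr: "trace (transp_mult n R R) = (\<Sum>i<n. R i \<bullet> R i)" for R :: "'q row_family"
    by (simp add: trace_def transp_mult_def inner_vec_def) (rule sum.swap)
  \<comment> \<open>Stated for an arbitrary family, since it is applied to the rows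
    \<open>X i v* H\<close> as well, where it yields the quadratic term.\<close>
  have E: "(\<Sum>i<n. E i \<bullet> (X i v* H)) = H \<bullet> transp_mult n X E" for E :: "'q row_family"
  proof -
    have "(\<Sum>i<n. E i \<bullet> (X i v* H)) = (\<Sum>i<n. \<Sum>l\<in>UNIV. \<Sum>k\<in>UNIV. H $ l $ k * (X i $ l * E i $ k))"
      by (simp add: inner_vec_def vector_matrix_mult_def sum_distrib_left mult_ac)
        (rule sum.cong[OF refl], rule sum.swap)
    also have "\<dots> = H \<bullet> transp_mult n X E"
      by (simp add: inner_vec_def transp_mult_def sum_distrib_left)
        (subst sum.swap, rule sum.cong[OF refl], rule sum.swap)
    finally show ?thesis .
  qed
  have "transp_mult n X (\<lambda>i. X i v* H) = transp_mult n X X ** H"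
    using transp_mult_response[of n X H "\<lambda>_. 0"] by (simp add: response_def transp_mult_def vec_eq_iff)
  then have q: "(\<Sum>i<n. (X i v* H) \<bullet> (X i v* H)) = H \<bullet> (transp_mult n X X ** H)"
    using E[of "\<lambda>i. X i v* H"] by simp
  have "(e - h) \<bullet> (e - h) = e \<bullet> e + h \<bullet> h - 2 * (e \<bullet> h)" for e h :: "real^'q"
    by (simp add: inner_diff_left inner_diff_right inner_commute[of h e])
  then have "(\<Sum>i<n. (E i - X i v* H) \<bullet> (E i - X i v* H)) =
    (\<Sum>i<n. E i \<bullet> E i) + (\<Sum>i<n. (X i v* H) \<bullet> (X i v* H)) - 2 * (\<Sum>i<n. E i \<bullet> (X i v* H))"
    by (simp add: sum.distrib sum_subtractf sum_distrib_left)
  then have "trace (transp_mult n (\<lambda>i. E i - X i v* H) (\<lambda>i. E i - X i v* H)) =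
    (\<Sum>i<n. E i \<bullet> E i) + H \<bullet> (transp_mult n X X ** H) - 2 * (H \<bullet> transp_mult n X E)"
    unfolding tr q E .
  then show ?thesis
    unfolding one_step_objective_def Let_def r by (simp only: vector_add_component)
qed

text \<open>A coordinate hyperplane is a Lebesgue null set. Through this the pilot rows belonging to
  zero coefficients are almost surely nonzero, as the one-step objective requires.\<close>

lemma AE_mvnormal_component_nonzero: "AE x in mvnormal \<mu> V. x $ i \<noteq> 0"
proof -
  have "negligible {x. x $ i = (0::real)}" by (rule negligible_standard_hyperplane_cart)
  then have "{x. x $ i = (0::real)} \<in> null_sets lebesgue" by (simp add: negligible_iff_null_sets)
  moreover have "{x. x $ i = (0::real)} \<in> sets borel"
    by (intro borel_closed closed_Collect_eq continuous_intros)
  ultimately have "{x. x $ i = (0::real)} \<in> null_sets lborel"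
    by (simp add: null_sets_completion_iff)
  then have "AE x in lborel. x $ i \<noteq> (0::real)"
    by (rule AE_I') auto
  then show ?thesis
    unfolding mvnormal_def by (subst AE_density) (auto intro: measurable_compose[OF mvn_density_measurable])
qed

text \<open>The design is generic because the result is used twice: for all columns, where it
  supplies tightness, and for the first columns alone, where it supplies the limit law.\<close>

lemma conv_in_distr_regression_noise:
  fixes Z :: "nat \<Rightarrow> nat \<Rightarrow> real^'p" and \<Sigma> :: "real^'q^'q" and E :: "nat \<Rightarrow> 'w \<Rightarrow> nat \<Rightarrow> real^'q"
    and A :: "real^'p^'p"
  defines "An \<equiv> \<lambda>n. (1 / real n) *\<^sub>R transp_mult n (Z n) (Z n)"
  assumes prob: "\<And>n. prob_space (M n)" and \<Sigma>: "pos_def \<Sigma>"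
    and indep: "\<And>n. prob_space.indep_vars (M n) (\<lambda>_. borel) (\<lambda>i \<omega>. E n \<omega> i) {..<n}"
    and normal: "\<And>n i. i < n \<Longrightarrow> distr (M n) borel (\<lambda>\<omega>. E n \<omega> i) = mvnormal 0 \<Sigma>"
    and A: "pos_def A" and lim: "An \<longlonglongrightarrow> A"
  defines "T \<equiv> \<lambda>n \<omega>. vec_cols (matrix_inv (An n) ** ((1 / sqrt n) *\<^sub>R transp_mult n (Z n) (E n \<omega>)))"
  shows "conv_in_distr M T (mvnormal 0 (kronecker \<Sigma> (matrix_inv A)))"
    "\<forall>\<^sub>F n in sequentially. distr (M n) borel (T n) = mvnormal 0 (kronecker \<Sigma> (matrix_inv (An n)))"
proof -
  have sym: "transpose (An n) = An n" for n
    by (simp add: An_def transpose_scalar transpose_transp_mult)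
  obtain c where "c > 0"
    and "\<forall>\<^sub>F n in sequentially. \<forall>H::real^'q^'p. H \<bullet> (An n ** H) \<ge> c * (norm H)\<^sup>2"
    and pd: "\<forall>\<^sub>F n in sequentially. pos_def (An n)"
    by (rule eventually_coercive[OF sym lim A])
  have Em: "(\<lambda>\<omega>. E n \<omega> i) \<in> borel_measurable (M n)" if "i < n" for n i
    using indep[of n] that by (auto simp: prob_space.indep_vars_def[OF prob])
  show law: "\<forall>\<^sub>F n in sequentially. distr (M n) borel (T n) = mvnormal 0 (kronecker \<Sigma> (matrix_inv (An n)))"
    using pd eventually_gt_at_top[of 0]
  proof eventually_elim
    case (elim n)
    then show ?case
      unfolding T_def
      by (intro prob_space.distr_normalized_regression_noise[OF prob \<Sigma> _ _ _ indep normal]) (simp_all add: An_def)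
  qed
  show "conv_in_distr M T (mvnormal 0 (kronecker \<Sigma> (matrix_inv A)))"
  proof (rule conv_in_distr_mvnormal[OF prob _ law])
    have "(\<lambda>\<omega>. (1 / sqrt n) *\<^sub>R transp_mult n (Z n) (E n \<omega>)) \<in> borel_measurable (M n)" for n
      by (intro borel_measurable_scaleR borel_measurable_const measurable_transp_mult Em)
    then show "T n \<in> borel_measurable (M n)" for n
      unfolding T_def by (intro measurable_vec_cols measurable_matrix_mult)
    \<comment> \<open>The inverse covariance \<open>kronecker (matrix_inv \<Sigma>) B\<close> is
      linear in \<open>B\<close>, so its limit is taken entrywise and continuity of matrix inversion
      is avoided.\<close>
    have pdk: "pos_def (kronecker \<Sigma> (matrix_inv B))" and
      invk: "matrix_inv (kronecker \<Sigma> (matrix_inv B)) = kronecker (matrix_inv \<Sigma>) B"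
      if "pos_def B" for B :: "real^'p^'p"
    proof -
      show "pos_def (kronecker \<Sigma> (matrix_inv B))"
        using that \<Sigma> by (intro pos_def_kronecker pos_def_matrix_inv)
      have "matrix_inv (matrix_inv B) = B"
        by (rule inverse_eqI) (simp add: matrix_inv_mult pos_def_invertible that)
      then show "matrix_inv (kronecker \<Sigma> (matrix_inv B)) = kronecker (matrix_inv \<Sigma>) B"
        using that \<Sigma> by (simp add: matrix_inv_kronecker pos_def_invertible pos_def_matrix_inv)
    qed
    show "\<forall>\<^sub>F n in sequentially. pos_def (kronecker \<Sigma> (matrix_inv (An n)))"
      using pd by (rule eventually_mono) (rule pdk)
    show "pos_def (kronecker \<Sigma> (matrix_inv A))" using A by (rule pdk)
    have ev: "\<forall>\<^sub>F n in sequentially. kronecker (matrix_inv \<Sigma>) (An n) = matrix_inv (kronecker \<Sigma> (matrix_inv (An n)))"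
      using pd by (rule eventually_mono) (simp only: invk)
    have kl: "(\<lambda>n. kronecker (matrix_inv \<Sigma>) (An n)) \<longlonglongrightarrow> kronecker (matrix_inv \<Sigma>) A"
      unfolding kronecker_def by (intro tendsto_intros lim)
    show "(\<lambda>n. matrix_inv (kronecker \<Sigma> (matrix_inv (An n)))) \<longlonglongrightarrow> matrix_inv (kronecker \<Sigma> (matrix_inv A))"
      unfolding invk[OF A] using kl ev by (rule Lim_transform_eventually)
  qed
qed

lemma pos_def_upper_left:
  fixes A :: "real^('a::finite+'b::finite)^('a+'b)"
  assumes "pos_def A" shows "pos_def (upper_left A)"
proof -
  have tr: "transpose A = A" using assms by (simp add: pos_def_def)
  have sym: "A $ i $ j = A $ j $ i" for i j
    by (subst tr[symmetric]) (simp add: transpose_def)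
  have "x \<bullet> (upper_left A *v x) > 0" if "x \<noteq> 0" for x
  proof -
    define y :: "real^('a+'b)" where "y = (\<chi> j. case j of Inl i \<Rightarrow> x $ i | Inr k \<Rightarrow> 0)"
    have "y \<noteq> 0"
    proof
      assume "y = 0"
      then have "y $ Inl i = 0" for i by simp
      then show False using that by (simp add: y_def vec_eq_iff)
    qed
    then have "y \<bullet> (A *v y) > 0" using assms by (simp add: pos_def_def)
    also have "y \<bullet> (A *v y) = x \<bullet> (upper_left A *v x)"
      by (simp add: inner_matrix_vector_sum sum_UNIV_Plus y_def upper_left_def)
    finally show ?thesis .
  qed
  then show ?thesis
    by (simp add: pos_def_def upper_left_def transpose_def vec_eq_iff sym)
qed

text \<open>Translates \<open>penalized_minimizer\<close> to the original scale. Substituting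
  \<open>B0 + (1 / sqrt n) *\<^sub>R H\<close> divides the weight of a zero row by
  \<open>sqrt n\<close>, which is the meaning of \<open>d\<close>.\<close>

lemma one_step_minimizer:
  fixes X :: "('a::finite + 'b::finite) row_family" and E :: "'q::finite row_family" and B01 :: "real^'q^'a"
    and Bs Bh :: "real^'q^('a + 'b)" and d :: "'a + 'b \<Rightarrow> real"
    and n :: nat and lam :: real and p :: "real \<Rightarrow> real"
  defines "A \<equiv> (1 / real n) *\<^sub>R transp_mult n X X" and "W \<equiv> (1 / sqrt n) *\<^sub>R transp_mult n X E"
    and "B0 \<equiv> stack_rows B01 (0 :: real^'q^'b)" and "d \<equiv> \<lambda>j. lam * deriv p (norm (Bs $ j)) / sqrt n"
  assumes n: "n > 0" and pd: "pos_def A" and c: "c > 0"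
    and coercive: "\<And>H::real^'q^('a+'b). H \<bullet> (A ** H) \<ge> c * (norm H)\<^sup>2"
    and bounded: "\<And>H::real^'q^('a+'b). norm (A ** H) \<le> K0 * norm H"
    and K0: "K0 \<ge> 0" and W: "norm W \<le> K"
    and d_top: "\<And>i. 0 \<le> d (Inl i)" "\<And>i. d (Inl i) \<le> e"
    and R: "2 * K + e * CARD('a) \<le> R * c" and d_bot: "\<And>k. d (Inr k) > 2 * K0 * R + 2 * K"
    and min: "is_arg_min (one_step_objective n X (response X B0 E) lam p Bs) (\<lambda>_. True) Bh"
  shows "bottom_rows Bh = 0"
    "norm (sqrt n *\<^sub>R (top_rows Bh - B01) - matrix_inv (upper_left A) ** top_rows W) \<le> e * CARD('a) / c"
proof -
  define U where "U = sqrt n *\<^sub>R (Bh - B0)"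
  have sn: "sqrt n > 0" using n by simp
  \<comment> \<open>The factor \<open>sqrt n\<close> restores the original weight; the inner scaling
    by \<open>1 / sqrt n\<close> then makes \<open>d (Inl i)\<close> a Lipschitz constant of
    \<open>g i\<close>.\<close>
  define g where "g i u = (d (Inl i) * sqrt n) * norm (B01 $ i + (1 / sqrt n) *\<^sub>R u)" for i and u :: "real^'q"
  define Q where "Q H = H \<bullet> (A ** H) - 2 * (H \<bullet> W) + (\<Sum>i\<in>UNIV. g i (H $ Inl i))
    + (\<Sum>k\<in>UNIV. d (Inr k) * norm (H $ Inr k))" for H :: "real^'q^('a+'b)"
  have obj: "one_step_objective n X (response X B0 E) lam p Bs (B0 + (1 / sqrt n) *\<^sub>R H) = (\<Sum>i<n. E i \<bullet> E i) + Q H" for H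
  proof -
    have 1: "((1 / sqrt n) *\<^sub>R H) \<bullet> (transp_mult n X X ** ((1 / sqrt n) *\<^sub>R H)) = H \<bullet> (A ** H)"
      using n by (simp add: A_def bounded_bilinear.scaleR_left[OF bounded_bilinear_matrix_mult]
          bounded_bilinear.scaleR_right[OF bounded_bilinear_matrix_mult])
    have 2: "((1 / sqrt n) *\<^sub>R H) \<bullet> transp_mult n X E = H \<bullet> W"
      by (simp add: W_def)
    have B0: "B0 $ Inl i = B01 $ i" "B0 $ Inr k = 0" for i k
      by (simp_all add: B0_def stack_rows_def)
    have "lam * (\<Sum>j\<in>UNIV. deriv p (norm (Bs $ j)) * norm (B0 $ j + ((1 / sqrt n) *\<^sub>R H) $ j)) =
      (\<Sum>i\<in>UNIV. g i (H $ Inl i)) + (\<Sum>k\<in>UNIV. d (Inr k) * norm (H $ Inr k))"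
      using sn by (simp add: sum_UNIV_Plus B0 distrib_left sum_distrib_left g_def d_def mult_ac)
    then show ?thesis
      unfolding one_step_objective_expand 1 2 Q_def by simp
  qed
  have BhU: "Bh = B0 + (1 / sqrt n) *\<^sub>R U" using sn by (simp add: U_def)
  have minQ: "Q U \<le> Q H" for H
  proof -
    let ?f = "one_step_objective n X (response X B0 E) lam p Bs"
    have "\<not> ?f (B0 + (1 / sqrt n) *\<^sub>R H) < ?f Bh" using min unfolding is_arg_min_def by blast
    moreover have "?f Bh = (\<Sum>i<n. E i \<bullet> E i) + Q U" using obj[of U] by (simp only: BhU[symmetric])
    ultimately show ?thesis using obj[of H] by linarith
  qed
  have g: "\<bar>g i u - g i v\<bar> \<le> e * norm (u - v)" for i u v
  proof -
    have "\<bar>g i u - g i v\<bar> = d (Inl i) * sqrt n * \<bar>norm (B01 $ i + (1 / sqrt n) *\<^sub>R u) - norm (B01 $ i + (1 / sqrt n) *\<^sub>R v)\<bar>"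
      using d_top(1)[of i] sn by (simp add: g_def abs_mult flip: right_diff_distrib)
    also have "\<dots> \<le> d (Inl i) * sqrt n * norm ((B01 $ i + (1 / sqrt n) *\<^sub>R u) - (B01 $ i + (1 / sqrt n) *\<^sub>R v))"
      using d_top(1)[of i] by (intro mult_left_mono norm_triangle_ineq3) auto
    also have "(B01 $ i + (1 / sqrt n) *\<^sub>R u) - (B01 $ i + (1 / sqrt n) *\<^sub>R v) = (1 / sqrt n) *\<^sub>R (u - v)"
      by (simp add: scaleR_diff_right)
    also have "d (Inl i) * sqrt n * norm ((1 / sqrt n) *\<^sub>R (u - v)) = d (Inl i) * norm (u - v)"
      using sn by simp
    also have "\<dots> \<le> e * norm (u - v)" using d_top(2)[of i] by (intro mult_right_mono) auto
    finally show ?thesis .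
  qed
  have e: "e \<ge> 0" using d_top order_trans by blast
  have V: "upper_left A ** (matrix_inv (upper_left A) ** top_rows W) = top_rows W"
    using pos_def_invertible[OF pos_def_upper_left[OF pd]]
    by (simp add: matrix_mul_assoc matrix_inv_mult)
  have "transpose A = A" using pd by (simp add: pos_def_def)
  note pm = penalized_minimizer[OF this c coercive bounded K0 W g e R d_bot minQ[unfolded Q_def] V]
  have "U $ Inr k = sqrt n *\<^sub>R Bh $ Inr k" for k
    by (simp add: U_def B0_def stack_rows_def)
  then show "bottom_rows Bh = 0"
    using pm(1) sn by (simp add: bottom_rows_def vec_eq_iff)
  have "top_rows U = sqrt n *\<^sub>R (top_rows Bh - B01)"
    by (simp add: U_def B0_def stack_rows_def top_rows_def vec_eq_iff)
  then show "norm (sqrt n *\<^sub>R (top_rows Bh - B01) - matrix_inv (upper_left A) ** top_rows W) \<le> e * CARD('a) / c"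
    using pm(2) by simp
qed

text \<open>An invertible Gram matrix \<open>S\<close> has only one generalized inverse: with
  \<open>P\<close> its inverse, \<open>S ** G = S ** G ** S ** P = S ** P = mat 1\<close>. The
  estimation error is thus linear in the noise.\<close>

lemma ls_estimate_response:
  fixes X :: "'p::finite row_family" and B :: "real^'q^'p"
  assumes n: "n > 0" and inv: "invertible ((1 / real n) *\<^sub>R transp_mult n X X)"
    and G: "generalized_inverse (transp_mult n X X) G"
  shows "ls_estimate n G X (response X B E) = B + (1 / sqrt n) *\<^sub>R
    (matrix_inv ((1 / real n) *\<^sub>R transp_mult n X X) ** ((1 / sqrt n) *\<^sub>R transp_mult n X E))"
proof -
  let ?S = "transp_mult n X X" and ?A = "(1 / real n) *\<^sub>R transp_mult n X X"
  note sc = bounded_bilinear.scaleR_left[OF bounded_bilinear_matrix_mult]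
    bounded_bilinear.scaleR_right[OF bounded_bilinear_matrix_mult]
  define P where "P = (1 / real n) *\<^sub>R matrix_inv ?A"
  have SP: "?S ** P = mat 1"
    using matrix_inv_mult(1)[OF inv] unfolding P_def by (simp only: sc)
  have "?S ** G = ?S ** G ** (?S ** P)" unfolding SP by simp
  also have "\<dots> = (?S ** G ** ?S) ** P" by (simp only: matrix_mul_assoc)
  also have "\<dots> = mat 1" using G SP by (simp add: generalized_inverse_def)
  finally have SG: "?S ** G = mat 1" .
  have GP: "G = P" using inverse_eqI(1)[OF SG] inverse_eqI(1)[OF SP] by simp
  have GS: "G ** ?S = mat 1" using matrix_inv_mult(2)[OF inverse_eqI(2)[OF SG]] inverse_eqI(1)[OF SG] by simp
  have "(1 / sqrt n) * (1 / sqrt n) = 1 / real n" using n by simp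
  then have GE: "G ** transp_mult n X E = (1 / sqrt n) *\<^sub>R (matrix_inv ?A ** ((1 / sqrt n) *\<^sub>R transp_mult n X E))"
    unfolding GP P_def by (simp only: sc scaleR_scaleR)
  have "ls_estimate n G X (response X B E) = (G ** ?S) ** B + G ** transp_mult n X E"
    by (simp only: ls_estimate_def transp_mult_response bounded_bilinear.add_right[OF bounded_bilinear_matrix_mult]
        matrix_mul_assoc)
  then show ?thesis unfolding GS GE by simp
qed

lemma vec_cols_diff: "vec_cols (A - B) = vec_cols A - vec_cols B"
  by (simp add: vec_cols_def vec_eq_iff)

lemma vec_cols_scaleR: "vec_cols (c *\<^sub>R A) = c *\<^sub>R vec_cols A"
  by (simp add: vec_cols_def vec_eq_iff)

lemma vec_cols_0 [simp]: "vec_cols 0 = 0"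
  by (simp add: vec_cols_def vec_eq_iff)

theorem theorem3p1:
  fixes \<Sigma> :: "real^'q::finite^'q"
    and B01 :: "real^'q^'p1::finite"
    and B0 :: "real^'q^('p1 + 'p0::finite)"
    and C :: "real^('p1 + 'p0)^('p1 + 'p0)"
    and M :: "nat \<Rightarrow> 'w measure"
    and X :: "nat \<Rightarrow> ('p1 + 'p0) row_family"
    and E :: "nat \<Rightarrow> 'w \<Rightarrow> 'q row_family"
    and Y :: "nat \<Rightarrow> 'w \<Rightarrow> 'q row_family"
    and D :: "real^'q \<Rightarrow> (real^'q) measure \<Rightarrow> real"
    and F :: "(real^'q) measure"
    and Dm :: "real^'q \<Rightarrow> real"
    and pF :: "real \<Rightarrow> real"
    and G :: "nat \<Rightarrow> real^('p1 + 'p0)^('p1 + 'p0)"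
    and Bstar Bhat :: "nat \<Rightarrow> 'w \<Rightarrow> real^'q^('p1 + 'p0)"
    and lam :: "nat \<Rightarrow> real"
    and s \<delta> :: real
  assumes Sigma: "pos_def \<Sigma>"
    and B0: "B0 = stack_rows B01 0"
    and B01: "\<And>i. B01 $ i \<noteq> 0"
    and prob: "\<And>n. prob_space (M n)"
    and E_indep: "\<And>n. prob_space.indep_vars (M n) (\<lambda>_. borel) (\<lambda>i \<omega>. E n \<omega> i) {..<n}"
    and E_normal: "\<And>n i. i < n \<Longrightarrow> distr (M n) borel (\<lambda>\<omega>. E n \<omega> i) = mvnormal 0 \<Sigma>"
    and Y: "\<And>n \<omega>. Y n \<omega> = response (X n) B0 (E n \<omega>)"
    and depth: "data_depth D"
    and F: "borel_prob F" "spherically_symmetric F"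
    and Dm: "inverse_depth D F Dm"
    and pF: "\<And>b. Dm b = pF (norm b)"
    and pF_concave: "concave_on {0..} pF"
    and pF_C1: "\<And>r. r > 0 \<Longrightarrow> pF differentiable (at r)" "continuous_on {0<..} (deriv pF)"
    and G: "\<And>n. generalized_inverse (transp_mult n (X n) (X n)) (G n)"
    and Bstar: "\<And>n \<omega>. Bstar n \<omega> = ls_estimate n (G n) (X n) (Y n \<omega>)"
    and Bhat_rv: "\<And>n. Bhat n \<in> borel_measurable (M n)"
    and Bhat: "\<And>n \<omega>. \<omega> \<in> space (M n) \<Longrightarrow> \<forall>j. Bstar n \<omega> $ j \<noteq> 0 \<Longrightarrow>
      is_arg_min (one_step_objective n (X n) (Y n \<omega>) (lam n) pF (Bstar n \<omega>)) (\<lambda>_. True) (Bhat n \<omega>)"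
    and C: "pos_def C"
    and i: "(\<lambda>n. (1 / real n) *\<^sub>R transp_mult n (X n) (X n)) \<longlonglongrightarrow> C"
    and s: "s > 0" and \<delta>: "\<delta> > 0"
    and ii: "exact_order_on
      {r. 0 < r \<and> r < \<delta> \<and> (\<exists>n. \<exists>\<omega> \<in> space (M n). \<exists>j. r = norm (Bstar n \<omega> $ j))}
      (deriv pF) (\<lambda>r. r powr (- s))"
    and iii: "(\<lambda>n. lam n / sqrt (real n)) \<longlonglongrightarrow> 0"
      "filterlim (\<lambda>n. lam n * real n powr ((s - 1) / 2)) at_top sequentially"
  shows "conv_in_prob M (\<lambda>n \<omega>. vec_cols (bottom_rows (Bhat n \<omega>))) 0 \<and>
    conv_in_distr M
      (\<lambda>n \<omega>. sqrt (real n) *\<^sub>R (vec_cols (top_rows (Bhat n \<omega>)) - vec_cols B01))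
      (mvnormal 0 (kronecker \<Sigma> (matrix_inv (upper_left C))))"
proof -

  \<comment> \<open>Rescaled statistics and their limit laws\<close>
  define Cn where "Cn n = (1 / real n) *\<^sub>R transp_mult n (X n) (X n)" for n
  define W where "W n \<omega> = (1 / sqrt n) *\<^sub>R transp_mult n (X n) (E n \<omega>)" for n \<omega>
  define T where "T n \<omega> = matrix_inv (Cn n) ** W n \<omega>" for n \<omega>
  define V where "V n \<omega> = matrix_inv (upper_left (Cn n)) ** top_rows (W n \<omega>)" for n \<omega>
  \<comment> \<open>The columns of the design that belong to nonzero rows.
    \<open>upper_left (Cn n)\<close> is their normalised Gram matrix, so \<open>V\<close> is the
    scaled least squares error of the regression on these columns.\<close>
  define X1 :: "nat \<Rightarrow> 'p1 row_family" where "X1 n = (\<lambda>i. \<chi> j. X n i $ Inl j)" for n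
  have symC: "transpose (Cn n) = Cn n" for n
    by (simp add: Cn_def transpose_scalar transpose_transp_mult)
  have limC: "Cn \<longlonglongrightarrow> C" using i by (simp add: Cn_def[abs_def])
  have ul: "upper_left (Cn n) = (1 / real n) *\<^sub>R transp_mult n (X1 n) (X1 n)" for n
    by (simp add: Cn_def X1_def upper_left_def transp_mult_def vec_eq_iff)
  have tw: "top_rows (W n \<omega>) = (1 / sqrt n) *\<^sub>R transp_mult n (X1 n) (E n \<omega>)" for n \<omega>
    by (simp add: W_def X1_def top_rows_def transp_mult_def vec_eq_iff)
  have lim11: "(\<lambda>n. upper_left (Cn n)) \<longlonglongrightarrow> upper_left C"
    unfolding upper_left_def by (intro tendsto_intros limC)
  have pd11: "pos_def (upper_left C)" using C by (rule pos_def_upper_left)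
  have convT: "conv_in_distr M (\<lambda>n \<omega>. vec_cols (T n \<omega>)) (mvnormal 0 (kronecker \<Sigma> (matrix_inv C)))"
    unfolding T_def W_def Cn_def
    by (rule conv_in_distr_regression_noise(1)[OF prob Sigma E_indep E_normal C limC[unfolded Cn_def[abs_def]]])
  have lawT: "\<forall>\<^sub>F n in sequentially. distr (M n) borel (\<lambda>\<omega>. vec_cols (T n \<omega>)) =
      mvnormal 0 (kronecker \<Sigma> (matrix_inv (Cn n)))"
    unfolding T_def W_def Cn_def
    by (rule conv_in_distr_regression_noise(2)[OF prob Sigma E_indep E_normal C limC[unfolded Cn_def[abs_def]]])
  have convV: "conv_in_distr M (\<lambda>n \<omega>. vec_cols (V n \<omega>)) (mvnormal 0 (kronecker \<Sigma> (matrix_inv (upper_left C))))"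
    unfolding V_def tw ul
    by (rule conv_in_distr_regression_noise(1)[OF prob Sigma E_indep E_normal pd11 lim11[unfolded ul]])
  have pN: "prob_space (mvnormal 0 (kronecker \<Sigma> (matrix_inv (upper_left C))))"
    "prob_space (mvnormal 0 (kronecker \<Sigma> (matrix_inv C)))"
    using Sigma C pd11 by (intro prob_space_mvnormal pos_def_kronecker pos_def_matrix_inv; simp)+

  \<comment> \<open>Sign, monotonicity and order of the penalty derivative\<close>
  have pF_nonneg: "pF r \<ge> 0" if r: "r \<ge> 0" for r
  proof -
    \<comment> \<open>Every nonnegative number is the norm of some vector, so nonnegativity of
      \<open>Dm\<close> passes to the whole half-line.\<close>
    obtain b :: "real^'q" where "norm b = r" using vector_choose_size[OF r] by blast
    then show ?thesis using Dm pF[of b] unfolding inverse_depth_def by metis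
  qed
  have dp: "0 < r \<Longrightarrow> deriv pF r \<ge> 0" "0 < r \<Longrightarrow> r \<le> t \<Longrightarrow> deriv pF t \<le> deriv pF r" for r t
    by (rule concave_nonneg_deriv[OF pF_concave pF_nonneg pF_C1(1)]; assumption)+
  \<comment> \<open>The order bound is available only at norms that rows of \<open>Bstar\<close>
    actually take, so membership is later witnessed by the sample point at hand.\<close>
  define S where "S = {r. 0 < r \<and> r < \<delta> \<and> (\<exists>n. \<exists>\<omega>\<in>space (M n). \<exists>j. r = norm (Bstar n \<omega> $ j))}"
  obtain a where a: "a > 0" "\<And>r. r \<in> S \<Longrightarrow> a * \<bar>r powr (- s)\<bar> \<le> \<bar>deriv pF r\<bar>"
    using ii unfolding exact_order_on_def S_def by blast

  \<comment> \<open>Constants uniform in the sample size\<close>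
  obtain c where c: "c > 0"
    "\<forall>\<^sub>F n in sequentially. \<forall>H::real^'q^('p1+'p0). H \<bullet> (Cn n ** H) \<ge> c * (norm H)\<^sup>2"
    "\<forall>\<^sub>F n in sequentially. pos_def (Cn n)"
    by (rule eventually_coercive[OF symC limC C])
  obtain Kb where Kb: "Kb > 0"
    "\<And>(A::real^('p1+'p0)^('p1+'p0)) (H::real^'q^('p1+'p0)). norm (A ** H) \<le> norm A * norm H * Kb"
    using bounded_bilinear.pos_bounded[OF bounded_bilinear_matrix_mult] by metis
  define K0 where "K0 = (norm C + 1) * Kb"
  have K0: "K0 \<ge> 0" using Kb by (simp add: K0_def)
  have bounded: "\<forall>\<^sub>F n in sequentially. \<forall>H::real^'q^('p1+'p0). norm (Cn n ** H) \<le> K0 * norm H"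
  proof -
    have "\<forall>\<^sub>F n in sequentially. norm (Cn n) < norm C + 1"
      using tendsto_norm[OF limC] by (rule order_tendstoD) simp
    then show ?thesis
    proof eventually_elim
      case (elim n)
      show ?case
      proof
        fix H :: "real^'q^('p1+'p0)"
        have "norm (Cn n ** H) \<le> norm (Cn n) * norm H * Kb" by (rule Kb(2))
        also have "\<dots> \<le> (norm C + 1) * norm H * Kb"
          using elim Kb by (intro mult_right_mono) auto
        finally show "norm (Cn n ** H) \<le> K0 * norm H" by (simp add: K0_def mult_ac)
      qed
    qed
  qed
  define m where "m = Min (range (\<lambda>i. norm (B01 $ i)))"
  have m: "m > 0" "\<And>i. m \<le> norm (B01 $ i)"
    using B01 by (auto simp: m_def Min_gr_iff)

  \<comment> \<open>Pathwise estimate on the events of bounded noise\<close>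
  have key: "\<forall>\<^sub>F n in sequentially. AE \<omega> in M n. norm (vec_cols (T n \<omega>)) \<le> K \<longrightarrow>
      bottom_rows (Bhat n \<omega>) = 0 \<and> norm (sqrt n *\<^sub>R (top_rows (Bhat n \<omega>) - B01) - V n \<omega>) \<le> \<eta>"
    if \<eta>: "\<eta> > 0" for K \<eta>
  proof -
    \<comment> \<open>\<open>K\<close> may be any real; a positive bound is needed for the power
      \<open>K1 powr (- s)\<close> and the division by it.\<close>
    define K1 where "K1 = max K 1"
    have K1: "K1 > 0" "K \<le> K1" by (auto simp: K1_def)
    define e where "e = min 1 (\<eta> * c / CARD('p1))"
    have e: "e > 0" "e \<le> 1" "e * CARD('p1) / c \<le> \<eta>"
      using \<eta> c(1) by (auto simp: e_def min_def field_simps)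
    \<comment> \<open>\<open>R\<close> and \<Lambda> are the constants of
      \<open>penalized_minimizer\<close> with \<open>K0 * K1\<close> as the bound for the norm of
      \<open>W n \<omega>\<close>.\<close>
    define R where "R = (2 * (K0 * K1) + e * CARD('p1)) / c"
    define \<Lambda> where "\<Lambda> = 2 * K0 * R + 2 * (K0 * K1)"
    have "(\<lambda>n. lam n / sqrt n * deriv pF (m / 2)) \<longlonglongrightarrow> 0 * deriv pF (m / 2)"
      by (intro tendsto_intros iii)
    then have ev1: "\<forall>\<^sub>F n in sequentially. lam n / sqrt n * deriv pF (m / 2) < e"
      using e by (intro order_tendstoD) auto
    have "(\<lambda>n. K1 * (1 / sqrt (real n))) \<longlonglongrightarrow> K1 * 0"
      by (intro tendsto_intros tendsto_divide_0[OF tendsto_const] filterlim_at_top_imp_at_infinity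
          filterlim_compose[OF sqrt_at_top filterlim_real_sequentially])
    \<comment> \<open>\<open>K1 / sqrt n\<close> bounds the displacement of each pilot row: below
      \<open>m / 2\<close> it keeps the nonzero rows away from 0, below \<delta> it puts the others
      in the range of the order condition.\<close>
    then have ev2: "\<forall>\<^sub>F n in sequentially. K1 * (1 / sqrt (real n)) < min \<delta> (m / 2)"
      using \<delta> m by (intro order_tendstoD) auto
    \<comment> \<open>The \<open>max 0\<close> also provides \<open>lam n > 0\<close>.\<close>
    have ev3: "\<forall>\<^sub>F n in sequentially. lam n * real n powr ((s - 1) / 2) > max 0 (\<Lambda> / (a * K1 powr (- s)))"
      by (rule iii(2)[unfolded filterlim_at_top_dense, rule_format])
    show ?thesis
      using c(2) c(3) bounded ev1 ev2 ev3 lawT eventually_gt_at_top[of 0]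
    proof eventually_elim
      case (elim n)
      note coercive = elim(1) and pd = elim(2) and bnd = elim(3) and law = elim(7) and n = elim(8)
      have sn: "sqrt n > 0" using n by simp
      have lam: "lam n > 0"
        using elim(6) by (metis max.strict_boundedE powr_ge_zero zero_less_mult_pos2 less_le mult_zero_right)
      have sd: "K1 * (1 / sqrt n) < \<delta>" "K1 * (1 / sqrt n) < m / 2"
        using elim(5) by (simp_all only: min_less_iff_conj)
      \<comment> \<open>Some response column: a nonzero entry of \<open>T\<close> in this one column
        already makes a lower row of \<open>Bstar\<close> nonzero.\<close>
      obtain k0 :: 'q where True by simp
      have Tm: "(\<lambda>\<omega>. vec_cols (T n \<omega>)) \<in> borel_measurable (M n)"
        using convT by (simp add: conv_in_distr_def)
      have "AE x in distr (M n) borel (\<lambda>\<omega>. vec_cols (T n \<omega>)). \<forall>k. x $ (k0, Inr k) \<noteq> 0"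
        unfolding law by (subst AE_all_countable) (intro allI AE_mvnormal_component_nonzero)
      then have "AE \<omega> in M n. \<forall>k. vec_cols (T n \<omega>) $ (k0, Inr k) \<noteq> 0"
        using Tm by (subst (asm) AE_distr_iff) auto
      then show ?case
      proof (rule AE_mp, intro AE_I2 impI)
        fix \<omega> assume \<omega>: "\<omega> \<in> space (M n)" and nz: "\<forall>k. vec_cols (T n \<omega>) $ (k0, Inr k) \<noteq> 0"
          and "norm (vec_cols (T n \<omega>)) \<le> K"
        then have TK: "norm (T n \<omega>) \<le> K1" using K1 by (simp add: norm_vec_cols)
        have Tj: "norm ((1 / sqrt n) *\<^sub>R T n \<omega> $ j) \<le> K1 * (1 / sqrt n)" for j
          using order_trans[OF Finite_Cartesian_Product.norm_nth_le TK, of j] sn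
          by (simp add: divide_right_mono)
        have inv: "invertible (Cn n)" using pd by (rule pos_def_invertible)
        \<comment> \<open>Bounds the noise \<open>W\<close> through \<open>T\<close>, so that one
          event controls both.\<close>
        have W_T: "W n \<omega> = Cn n ** T n \<omega>"
          by (simp add: T_def matrix_mul_assoc matrix_inv_mult[OF inv])
        have normW: "norm (W n \<omega>) \<le> K0 * K1"
          unfolding W_T using bnd TK K0 by (meson mult_left_mono order_trans)
        have Bs: "Bstar n \<omega> = B0 + (1 / sqrt n) *\<^sub>R T n \<omega>"
          using ls_estimate_response[OF n inv[unfolded Cn_def] G, of B0 "E n \<omega>"]
          by (simp add: Bstar Y T_def Cn_def W_def)
        have Bs_top: "norm (Bstar n \<omega> $ Inl i) \<ge> m / 2" for i
        proof -
          have "Bstar n \<omega> $ Inl i = B01 $ i + (1 / sqrt n) *\<^sub>R T n \<omega> $ Inl i"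
            by (simp add: Bs B0 stack_rows_def)
          then have "norm (B01 $ i) \<le> norm (Bstar n \<omega> $ Inl i) + norm ((1 / sqrt n) *\<^sub>R T n \<omega> $ Inl i)"
            by (metis add_diff_cancel_right' norm_triangle_ineq4)
          then show ?thesis using m(2)[of i] Tj[of "Inl i"] sd(2) by linarith
        qed
        have Bs_bot: "Bstar n \<omega> $ Inr k = (1 / sqrt n) *\<^sub>R T n \<omega> $ Inr k" for k
          by (simp add: Bs B0 stack_rows_def)
        have bot_nz: "Bstar n \<omega> $ Inr k \<noteq> 0" for k
        proof
          assume "Bstar n \<omega> $ Inr k = 0"
          then have "T n \<omega> $ Inr k = 0" using sn by (simp add: Bs_bot)
          then show False using nz[rule_format, of k] by (simp add: vec_cols_def)
        qed
        have "Bstar n \<omega> $ j \<noteq> 0" for j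
        proof (cases j)
          case (Inl i)
          then show ?thesis using Bs_top[of i] m(1) by auto
        next
          case (Inr k)
          then show ?thesis using bot_nz by simp
        qed
        then have argmin: "is_arg_min (one_step_objective n (X n) (response (X n) (stack_rows B01 0) (E n \<omega>)) (lam n) pF (Bstar n \<omega>))
            (\<lambda>_. True) (Bhat n \<omega>)"
          using Bhat[OF \<omega>] by (simp add: Y B0)
        have d_top: "0 \<le> lam n * deriv pF (norm (Bstar n \<omega> $ Inl i)) / sqrt n"
          "lam n * deriv pF (norm (Bstar n \<omega> $ Inl i)) / sqrt n \<le> e" for i
        proof -
          have pos: "norm (Bstar n \<omega> $ Inl i) > 0" using Bs_top[of i] m(1) by linarith
          then show "0 \<le> lam n * deriv pF (norm (Bstar n \<omega> $ Inl i)) / sqrt n"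
            using lam dp(1) by simp
          \<comment> \<open>A decreasing derivative bounds the random weights of all nonzero rows by
            one fixed number.\<close>
          have "deriv pF (norm (Bstar n \<omega> $ Inl i)) \<le> deriv pF (m / 2)"
            using Bs_top m(1) by (intro dp(2)) auto
          then have "lam n / sqrt n * deriv pF (norm (Bstar n \<omega> $ Inl i)) \<le> lam n / sqrt n * deriv pF (m / 2)"
            using lam by (intro mult_left_mono) auto
          then show "lam n * deriv pF (norm (Bstar n \<omega> $ Inl i)) / sqrt n \<le> e"
            using elim(4) by simp
        qed
        have d_bot: "lam n * deriv pF (norm (Bstar n \<omega> $ Inr k)) / sqrt n > \<Lambda>" for k
        proof -
          define r where "r = norm (Bstar n \<omega> $ Inr k)"
          have r: "0 < r" "r \<le> K1 * (1 / sqrt n)"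
            using bot_nz Tj[of "Inr k"] by (simp_all add: r_def Bs_bot)
          have "r < \<delta>" using r(2) sd(1) by linarith
          then have "r \<in> S" using r(1) \<omega> unfolding S_def r_def by blast
          then have "a * r powr (- s) \<le> deriv pF r" using a(2)[of r] dp(1)[OF r(1)] by simp
          moreover have "K1 powr (- s) * real n powr (s / 2) \<le> r powr (- s)"
          proof -
            have "(K1 * (1 / sqrt n)) powr (- s) \<le> r powr (- s)"
              using r s by (intro powr_mono2') auto
            moreover have "(K1 * (1 / sqrt n)) powr (- s) = K1 powr (- s) * real n powr (s / 2)"
            proof -
              have "1 / sqrt n = real n powr (- (1 / 2))"
                by (simp only: powr_minus_divide powr_half_sqrt of_nat_0_le_iff)
              then have "(K1 * (1 / sqrt n)) powr (- s) = K1 powr (- s) * (real n powr (- (1 / 2))) powr (- s)"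
                using K1 by (simp only: powr_mult)
              also have "(real n powr (- (1 / 2))) powr (- s) = real n powr (s / 2)"
                by (simp add: powr_powr)
              finally show ?thesis .
            qed
            ultimately show ?thesis by simp
          qed
          ultimately have dr: "a * (K1 powr (- s) * real n powr (s / 2)) \<le> deriv pF r"
            using a(1) by (meson mult_left_mono less_imp_le order_trans)
          \<comment> \<open>Splitting \<open>n powr ((s - 1) / 2)\<close> as
            \<open>n powr (s / 2) / sqrt n\<close> separates the growth of \<open>deriv pF\<close>
            near 0 from the factor of the rescaling.\<close>
          have "\<Lambda> < (a * K1 powr (- s)) * (lam n * real n powr ((s - 1) / 2))"
            using elim(6) a(1) K1(1) by (simp add: divide_less_eq mult_ac)
          also have "real n powr ((s - 1) / 2) = real n powr (s / 2) / sqrt n"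
            using n by (simp add: diff_divide_distrib powr_diff powr_half_sqrt)
          also have "(a * K1 powr (- s)) * (lam n * (real n powr (s / 2) / sqrt n)) =
              lam n / sqrt n * (a * (K1 powr (- s) * real n powr (s / 2)))"
            by simp
          also have "\<dots> \<le> lam n / sqrt n * deriv pF r"
            using dr lam by (intro mult_left_mono) auto
          finally show ?thesis by (simp add: r_def)
        qed
        have R: "2 * (K0 * K1) + e * CARD('p1) \<le> R * c"
          using c(1) by (simp add: R_def)
        note est = one_step_minimizer[OF n pd[unfolded Cn_def] c(1) coercive[unfolded Cn_def, rule_format]
            bnd[unfolded Cn_def, rule_format] K0 normW[unfolded W_def] d_top R d_bot[unfolded \<Lambda>_def] argmin]
        show "bottom_rows (Bhat n \<omega>) = 0 \<and> norm (sqrt n *\<^sub>R (top_rows (Bhat n \<omega>) - B01) - V n \<omega>) \<le> \<eta>"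
          using est e(3) unfolding V_def W_def Cn_def by simp
      qed
    qed
  qed

  \<comment> \<open>From the pathwise estimate to the two limits\<close>
  have bot_rv: "(\<lambda>\<omega>. vec_cols (bottom_rows (Bhat n \<omega>))) \<in> borel_measurable (M n)" for n
    unfolding bottom_rows_def by (intro measurable_vec_cols measurable_vec_lambda measurable_vec_nth Bhat_rv)
  have top_rv: "(\<lambda>\<omega>. sqrt n *\<^sub>R (vec_cols (top_rows (Bhat n \<omega>)) - vec_cols B01)) \<in> borel_measurable (M n)" for n
    unfolding top_rows_def
    by (intro borel_measurable_scaleR borel_measurable_diff borel_measurable_const measurable_vec_cols
        measurable_vec_lambda measurable_vec_nth Bhat_rv)
  show ?thesis
  proof
    show "conv_in_prob M (\<lambda>n \<omega>. vec_cols (bottom_rows (Bhat n \<omega>))) 0"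
      unfolding conv_in_prob_def
    proof (intro conjI allI impI bot_rv)
      fix \<epsilon> :: real assume "\<epsilon> > 0"
      show "(\<lambda>n. measure (M n) {\<omega> \<in> space (M n). dist (vec_cols (bottom_rows (Bhat n \<omega>))) 0 > \<epsilon>}) \<longlonglongrightarrow> 0"
      proof (rule dist_tendsto_0_in_prob[OF prob convT pN(2) sets_mvnormal])
        fix K
        show "\<forall>\<^sub>F n in sequentially. AE \<omega> in M n. norm (vec_cols (T n \<omega>)) \<le> K \<longrightarrow>
            dist (vec_cols (bottom_rows (Bhat n \<omega>))) 0 \<le> \<epsilon>"
          using key[OF \<open>\<epsilon> > 0\<close>, of K] by (rule eventually_mono) (use \<open>\<epsilon> > 0\<close> in \<open>auto elim!: AE_mp\<close>)
      qed
    qed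
    show "conv_in_distr M (\<lambda>n \<omega>. sqrt (real n) *\<^sub>R (vec_cols (top_rows (Bhat n \<omega>)) - vec_cols B01))
      (mvnormal 0 (kronecker \<Sigma> (matrix_inv (upper_left C))))"
    \<comment> \<open>The limit law is that of the restricted least squares error \<open>V\<close>;
      closeness to it is again controlled by the full error \<open>T\<close>.\<close>
    proof (rule conv_in_distr_perturb[OF prob convV pN(1) sets_mvnormal top_rv])
      fix \<eta> :: real assume "\<eta> > 0"
      show "(\<lambda>n. measure (M n) {\<omega> \<in> space (M n).
          dist (sqrt n *\<^sub>R (vec_cols (top_rows (Bhat n \<omega>)) - vec_cols B01)) (vec_cols (V n \<omega>)) > \<eta>}) \<longlonglongrightarrow> 0"
      proof (rule dist_tendsto_0_in_prob[OF prob convT pN(2) sets_mvnormal])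
        fix K
        have eq: "dist (sqrt n *\<^sub>R (vec_cols (top_rows (Bhat n \<omega>)) - vec_cols B01)) (vec_cols (V n \<omega>)) =
            norm (sqrt n *\<^sub>R (top_rows (Bhat n \<omega>) - B01) - V n \<omega>)" for n \<omega>
          by (simp only: dist_norm norm_vec_cols flip: vec_cols_diff vec_cols_scaleR)
        show "\<forall>\<^sub>F n in sequentially. AE \<omega> in M n. norm (vec_cols (T n \<omega>)) \<le> K \<longrightarrow>
            dist (sqrt n *\<^sub>R (vec_cols (top_rows (Bhat n \<omega>)) - vec_cols B01)) (vec_cols (V n \<omega>)) \<le> \<eta>"
          unfolding eq using key[OF \<open>\<eta> > 0\<close>, of K] by (rule eventually_mono) (auto elim!: AE_mp)
      qed
    qed
  qed
qed

end
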